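(* Let $Y=X\beta+\epsilon$ with $\epsilon\sim N(0,\sigma^2I_n)$ and $\|X_j\|_2=\sqrt n$ for all $j\in[p]$. Choose $\tau,a>0$ and set $\lambda_{p,\tau}=(\sqrt{1+a}+\tau^{-1})\sqrt{2\log p/n}$. Suppose $\beta$ is $s$-sparse, with $1\le s<n/3$ and $\delta_{2s}+\theta_{s,2s}<1-\tau$. Let $s_0$ be the essential sparsity of $\beta$. Let $\beta_{\mathrm{init}}$ be a solution of the Dantzig selector $$\min_{\tilde\beta\in\mathbb{R}^p}\|\tilde\beta\|_1\quad\text{subject to}\quad\|X^T(Y-X\tilde\beta)/n\|_\infty\le\lambda_n,\qquad\lambda_n=\lambda_{p,\tau}\sigma .$$ Let the threshold $t_0$ be chosen from the range $(C_1\lambda_{p,\tau}\sigma,\,C_4\lambda_{p,\tau}\sigma]$, with $C_1$ as in the context and $C_4\ge C_1$ a constant. Let $I=\{j\in[p]:|\beta_{j,\mathrm{init}}|\ge t_0\}$, $\hat\beta_I=(X_I^TX_I)^{-1}X_I^TY$, and $\hat\beta_j=0$ for $j\notin I$ (the Gauss-Dantzig selector with selected model $I$). Then with probability at least $1-(\sqrt{\pi\log p}\,p^a)^{-1}$, $$|I|\le2s_0,\qquad|I\setminus S|\le s_0\le s,\qquad\|\hat\beta-\beta\|_2^2\le C_3^2\lambda^2\sigma^2s_0,$$ with $C_3$ (depending on $a,\tau,\delta_{2s},\theta_{s,2s},C_4$ and $\Lambda_{\min}(2s_0)$) as in the context.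
   Context: Setting: $n,p$ are positive integers with $p\ge n$, $p\ge2$; $[p]=\{1,\dots,p\}$; $X\in\mathbb{R}^{n\times p}$ is a fixed design matrix with columns $X_j$; $\sigma>0$; $S=\mathrm{supp}(\beta)$ and $s=|S|$; $\lambda=\sqrt{2\log p/n}$. For $T\subseteq[p]$, $X_T$ is the submatrix of columns indexed by $T$. A vector is $m$-sparse if it has at most $m$ nonzero entries. Essential sparsity: $s_0$ is the smallest integer such that $\sum_{i=1}^p\min(\beta_i^2,\lambda^2\sigma^2)\le s_0\lambda^2\sigma^2$. $\Lambda_{\min}(m)=\min\|Xv\|_2^2/(n\|v\|_2^2)$ over nonzero $m$-sparse $v\in\mathbb{R}^p$. Restricted isometry constant: $\delta_m$ is the smallest number such that $(1-\delta_m)\|v\|_2^2\le\|X_Tv\|_2^2/n\le(1+\delta_m)\|v\|_2^2$ for all $T\subset[p]$ with $|T|\le m$ and all $v\in\mathbb{R}^{|T|}$. Restricted orthogonality constant: $\theta_{m,m'}$ is the smallest number such that $|\langle X_Tv,X_{T'}v'\rangle|/n\le\theta_{m,m'}\|v\|_2\|v'\|_2$ for all disjoint $T,T'\subseteq[p]$ with $|T|\le m$, $|T'|\le m'$ and all $v\in\mathbb{R}^{|T|},v'\in\mathbb{R}^{|T'|}$. Constants, with $\delta=\delta_{2s}$, $\theta=\theta_{s,2s}$: $$C_0=2\sqrt2\Big(1+\frac{1-\delta^2}{1-\delta-\theta}\Big)+\Big(1+\frac1{\sqrt2}\Big)\frac{(1+\delta)^2}{1-\delta-\theta},\qquad C_0'=\frac{C_0}{1-\delta-\theta}+\frac{\theta(1+\delta)}{(1-\delta-\theta)^2},$$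 $$C_1=C_0'+\frac{1+\delta}{1-\delta-\theta},\qquad C_3^2=3(\sqrt{1+a}+\tau^{-1})^2\big((C_0'+C_4)^2+1\big)+\frac{4(1+a)}{\Lambda_{\min}^2(2s_0)}.$$ *)

theory Defs
  imports "HOL-Probability.Probability"
begin

text \<open>
  The sample size is \<open>n = CARD('n)\<close> and the number of variables is \<open>p = CARD('p)\<close>. For a set
  of indices \<open>T\<close>, a vector indexed by \<open>T\<close> is represented as a vector indexed by the whole type
  \<open>'p\<close> that vanishes outside \<open>T\<close>, and the column submatrix \<open>X\<^sub>T\<close> as the matrix in which the
  columns outside \<open>T\<close> are replaced by zero.
\<close>

definition supp :: "real ^ 'p \<Rightarrow> 'p set"
  where "supp v = {j. v $ j \<noteq> 0}"

definition sparse :: "nat \<Rightarrow> real ^ 'p \<Rightarrow> bool"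
  where "sparse m v \<longleftrightarrow> card (supp v) \<le> m"

definition l1_norm :: "real ^ 'p \<Rightarrow> real"
  where "l1_norm v = (\<Sum>j\<in>UNIV. \<bar>v $ j\<bar>)"

definition cols :: "'p set \<Rightarrow> real ^ 'p ^ 'n \<Rightarrow> real ^ 'p ^ 'n"
  where "cols T X = (\<chi> i j. if j \<in> T then X $ i $ j else 0)"

definition base_lambda :: "nat \<Rightarrow> nat \<Rightarrow> real"
  where "base_lambda n p = sqrt (2 * ln (real p) / real n)"

text \<open>
  The left-hand side below is nonnegative, so for a positive level \<open>l\<close> (standing for
  \<open>\<lambda> \<sigma>\<close>) the smallest integer is a natural number.
\<close>

definition essential_sparsity :: "real \<Rightarrow> real ^ 'p \<Rightarrow> nat"
  where "essential_sparsity l \<beta> =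
    (LEAST k::nat. (\<Sum>i\<in>UNIV. min ((\<beta> $ i)\<^sup>2) (l\<^sup>2)) \<le> real k * l\<^sup>2)"

text \<open>
  The infimum is a minimum for \<open>m \<ge> 1\<close>: the quotient is scale invariant, and the \<open>m\<close>-sparse
  unit vectors form a nonempty compact set.
\<close>

definition Lambda_min :: "real ^ 'p ^ 'n \<Rightarrow> nat \<Rightarrow> real"
  where "Lambda_min X m =
    (INF v\<in>{v. v \<noteq> 0 \<and> sparse m v}. (norm (X *v v))\<^sup>2 / (real CARD('n) * (norm v)\<^sup>2))"

definition restricted_isometry :: "real ^ 'p ^ 'n \<Rightarrow> nat \<Rightarrow> real"
  where "restricted_isometry X m =
    (LEAST d::real. \<forall>T v. card T \<le> m \<and> supp v \<subseteq> T \<longrightarrow>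
       (1 - d) * (norm v)\<^sup>2 \<le> (norm (cols T X *v v))\<^sup>2 / real CARD('n) \<and>
       (norm (cols T X *v v))\<^sup>2 / real CARD('n) \<le> (1 + d) * (norm v)\<^sup>2)"

definition restricted_orthogonality :: "real ^ 'p ^ 'n \<Rightarrow> nat \<Rightarrow> nat \<Rightarrow> real"
  where "restricted_orthogonality X m m' =
    (LEAST c::real. \<forall>T T' v v'. T \<inter> T' = {} \<and> card T \<le> m \<and> card T' \<le> m' \<and>
         supp v \<subseteq> T \<and> supp v' \<subseteq> T' \<longrightarrow>
       \<bar>(cols T X *v v) \<bullet> (cols T' X *v v')\<bar> / real CARD('n) \<le> c * norm v * norm v')"

definition C0 :: "real \<Rightarrow> real \<Rightarrow> real"
  where "C0 \<delta> \<theta> = 2 * sqrt 2 * (1 + (1 - \<delta>\<^sup>2) / (1 - \<delta> - \<theta>))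
    + (1 + 1 / sqrt 2) * (1 + \<delta>)\<^sup>2 / (1 - \<delta> - \<theta>)"

definition C0' :: "real \<Rightarrow> real \<Rightarrow> real"
  where "C0' \<delta> \<theta> = C0 \<delta> \<theta> / (1 - \<delta> - \<theta>) + \<theta> * (1 + \<delta>) / (1 - \<delta> - \<theta>)\<^sup>2"

definition C1 :: "real \<Rightarrow> real \<Rightarrow> real"
  where "C1 \<delta> \<theta> = C0' \<delta> \<theta> + (1 + \<delta>) / (1 - \<delta> - \<theta>)"

definition C3 :: "real \<Rightarrow> real \<Rightarrow> real \<Rightarrow> real \<Rightarrow> real \<Rightarrow> real \<Rightarrow> real"
  where "C3 a \<tau> \<delta> \<theta> C4 \<Lambda> =
    sqrt (3 * (sqrt (1 + a) + 1 / \<tau>)\<^sup>2 * ((C0' \<delta> \<theta> + C4)\<^sup>2 + 1) + 4 * (1 + a) / \<Lambda>\<^sup>2)"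

text \<open>The law \<open>N(0, \<sigma>\<^sup>2 I)\<close> on \<open>real ^ 'n\<close>: independent \<open>N(0, \<sigma>\<^sup>2)\<close> coordinates.\<close>

definition isotropic_gaussian :: "'w measure \<Rightarrow> real \<Rightarrow> ('w \<Rightarrow> real ^ 'n) \<Rightarrow> bool"
  where "isotropic_gaussian M \<sigma> \<epsilon> \<longleftrightarrow>
    prob_space.indep_vars M (\<lambda>_. borel) (\<lambda>i \<omega>. \<epsilon> \<omega> $ i) UNIV \<and>
    (\<forall>i. distributed M lborel (\<lambda>\<omega>. \<epsilon> \<omega> $ i) (\<lambda>x. ennreal (normal_density 0 \<sigma> x)))"

definition dantzig_feasible :: "real ^ 'p ^ 'n \<Rightarrow> real ^ 'n \<Rightarrow> real \<Rightarrow> real ^ 'p \<Rightarrow> bool"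
  where "dantzig_feasible X Y l b \<longleftrightarrow>
    infnorm ((1 / real CARD('n)) *\<^sub>R (transpose X *v (Y - X *v b))) \<le> l"

definition dantzig_solution :: "real ^ 'p ^ 'n \<Rightarrow> real ^ 'n \<Rightarrow> real \<Rightarrow> real ^ 'p \<Rightarrow> bool"
  where "dantzig_solution X Y l b \<longleftrightarrow> dantzig_feasible X Y l b \<and>
    (\<forall>b'. dantzig_feasible X Y l b' \<longrightarrow> l1_norm b \<le> l1_norm b')"

text \<open>
  The inverse of the \<open>I \<times> I\<close> block of \<open>A\<close>, extended by zero to a matrix indexed by the whole
  type. It is uniquely determined when the block is invertible, and unspecified otherwise.
\<close>

definition block_inverse :: "'p set \<Rightarrow> real ^ 'p ^ 'p \<Rightarrow> real ^ 'p ^ 'p"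
  where "block_inverse I A = (THE B.
    (\<forall>i j. i \<notin> I \<or> j \<notin> I \<longrightarrow> B $ i $ j = 0) \<and>
    (\<forall>i\<in>I. \<forall>j\<in>I. (\<Sum>k\<in>I. A $ i $ k * B $ k $ j) = (if i = j then 1 else 0)
                \<and> (\<Sum>k\<in>I. B $ i $ k * A $ k $ j) = (if i = j then 1 else 0)))"

definition restricted_least_squares :: "real ^ 'p ^ 'n \<Rightarrow> real ^ 'n \<Rightarrow> 'p set \<Rightarrow> real ^ 'p"
  where "restricted_least_squares X Y I =
    (\<chi> j. if j \<in> I
         then (block_inverse I (transpose (cols I X) ** cols I X) *v (transpose (cols I X) *v Y)) $ j
         else 0)"

end

theory Submission
  imports Defs "HOL-Real_Asymp.Real_Asymp"
begin

text \<open>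
  Write \<open>G = X\<^sup>T X / n\<close>, \<open>\<mu> = \<lambda> \<sigma>\<close>, \<open>\<kappa> = sqrt (1 + a) \<mu>\<close>, \<open>\<nu> = \<mu> / \<tau>\<close> and \<open>k\<close> for the essential sparsity, so
  that the level of the Dantzig constraint is \<open>l = \<kappa> + \<nu>\<close>. Probability enters once
  (\<open>noise_correlation_bound\<close>): the correlation of a column with the noise is a centred Gaussian, and
  the Mills ratio bound with a union bound over the columns shows that all correlations are at
  most \<open>\<kappa>\<close> outside an event of the stated probability. The rest is a deterministic statement on
  this event (\<open>gauss_dantzig_deterministic\<close>).

  The point is to obtain bounds in terms of \<open>k\<close> instead of \<open>s\<close>. Comparing the Dantzig solution
  with \<open>\<beta>\<close> itself is not enough: off the set \<open>T0\<close> of the \<open>k\<close> largest entries, the entries of \<open>\<beta>\<close>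
  are only known to have \<open>\<ell>\<^sub>2\<close> norm at most \<open>sqrt k \<mu>\<close>, and their \<open>\<ell>\<^sub>1\<close> norm can be as large as
  \<open>sqrt (s k) \<mu>\<close>. Let \<open>\<beta>1\<close> and \<open>\<beta>2\<close> be the parts of \<open>\<beta>\<close> on \<open>T0\<close> and off \<open>T0\<close>. The competitor is
  \<open>\<beta>1 + b\<close>, where \<open>b\<close> minimises the noiseless Lasso functional
  \<open>(\<beta>2 - b)\<^sup>T G (\<beta>2 - b) / 2 + \<nu> \<parallel>b\<parallel>\<^sub>1\<close> (\<open>lasso_approximation\<close>). Stationarity gives
  \<open>\<parallel>G (\<beta>2 - b)\<parallel>\<^sub>\<infinity> \<le> \<nu>\<close>, which is the slack in the Dantzig constraint, so \<open>\<beta>1 + b\<close> is feasible.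
  Comparison with the value at \<open>0\<close> gives \<open>\<parallel>b\<parallel>\<^sub>1 \<le> (1 + \<delta>) \<parallel>\<beta>2\<parallel>\<^sup>2 / (2 \<nu>)\<close>, which is of order
  \<open>\<mu> k\<close>. Minimality of the Dantzig solution then puts \<open>u = init - \<beta>1\<close> into a cone, and restricted
  isometry and orthogonality bound \<open>u\<close> on \<open>T0\<close> in \<open>\<ell>\<^sub>2\<close> by \<open>C0' l sqrt k\<close> and off \<open>T0\<close> in \<open>\<ell>\<^sub>1\<close>
  by \<open>C1 l k\<close> (\<open>head_estimate\<close>, \<open>dantzig_head_tail\<close>).

  The threshold exceeds \<open>C1 l\<close>, so at most \<open>k\<close> indices off \<open>T0\<close> survive it; an entry of \<open>\<beta>\<close> on
  \<open>T0\<close> that is lost is at most the error of the Dantzig solution there plus the threshold. In the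
  least squares refit on the selected set (\<open>least_squares_error\<close>) the missed part of \<open>\<beta>\<close> leaks into
  the estimate with a factor at most \<open>\<theta> / \<Lambda>\<^sub>m\<^sub>i\<^sub>n\<close>, which is at most \<open>1\<close>, and the noise
  contributes \<open>sqrt (2 k) \<kappa> / \<Lambda>\<^sub>m\<^sub>i\<^sub>n\<close>. Squaring yields the factors \<open>3\<close> and \<open>4\<close> of \<open>C3\<close>.
\<close>

section \<open>Sums over decreasing blocks\<close>

lemma top_subset:
  fixes f :: "'a \<Rightarrow> real"
  assumes "finite A" and "m \<le> card A"
  shows "\<exists>T\<subseteq>A. card T = m \<and> (\<forall>i\<in>T. \<forall>j\<in>A - T. f j \<le> f i)"
  using assms(2)
proof (induction m)
  case 0
  then show ?case by (intro exI[of _ "{}"]) auto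
next
  case (Suc m)
  then obtain T where T: "T \<subseteq> A" "card T = m" "\<forall>i\<in>T. \<forall>j\<in>A - T. f j \<le> f i" by auto
  have fin: "finite (A - T)" "finite T" using assms(1) T(1) by (auto intro: finite_subset)
  have "A - T \<noteq> {}"
    using Suc.prems T(1,2) assms(1) by (metis Diff_eq_empty_iff card_mono fin(2) not_less_eq_eq)
  then have "Max (f ` (A - T)) \<in> f ` (A - T)" using fin(1) by (intro Max_in) auto
  then obtain k where "k \<in> A - T" "f k = Max (f ` (A - T))" by force
  then have k: "k \<in> A - T" "\<forall>j\<in>A - T. f j \<le> f k" using fin(1) by auto
  show ?case
    by (rule exI[of _ "insert k T"]) (use T k fin in auto)
qed

text \<open>
  This is how orthogonality of small sets of columns is used against a long tail. The index set is
  cut into blocks of \<open>m\<close> indices in decreasing order of \<open>\<bar>u\<bar>\<close>. The \<open>\<ell>\<^sub>2\<close> norm of a block is at most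
  \<open>sqrt m\<close> times its largest entry, which is at most the mean of \<open>\<bar>u\<bar>\<close> over the preceding block,
  so the norms of all blocks but the first add up to at most \<open>\<parallel>u\<parallel>\<^sub>1 / sqrt m\<close>. For the first, \<open>B\<close> replaces the
  missing predecessor.
\<close>

lemma block_sum_bound:
  fixes u \<phi> :: "'a \<Rightarrow> real"
  assumes "finite A" and "0 < m" and "0 \<le> c" and "0 \<le> B"
    and block: "\<And>T. T \<subseteq> A \<Longrightarrow> card T \<le> m \<Longrightarrow> \<bar>\<Sum>j\<in>T. \<phi> j\<bar> \<le> c * sqrt (\<Sum>j\<in>T. (u j)\<^sup>2)"
    and "\<And>j. j \<in> A \<Longrightarrow> \<bar>u j\<bar> \<le> B"
  shows "\<bar>\<Sum>j\<in>A. \<phi> j\<bar> \<le> c * (sqrt m * B + (\<Sum>j\<in>A. \<bar>u j\<bar>) / sqrt m)"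
  using assms(1,4-)
proof (induction "card A" arbitrary: A B rule: less_induct)
  case less
  have m0: "sqrt (real m) > 0" using \<open>0 < m\<close> by simp
  have head: "\<bar>\<Sum>j\<in>T. \<phi> j\<bar> \<le> c * (sqrt m * B)" if T: "T \<subseteq> A" "card T \<le> m" for T
  proof -
    have "(\<Sum>j\<in>T. (u j)\<^sup>2) \<le> (\<Sum>j\<in>T. B\<^sup>2)"
      using T less.prems(4) by (intro sum_mono) (metis abs_ge_zero power2_abs power_mono subsetD)
    also have "\<dots> \<le> real m * B\<^sup>2"
      using T(2) by (simp add: mult_right_mono)
    finally have "sqrt (\<Sum>j\<in>T. (u j)\<^sup>2) \<le> sqrt m * B"
      using less.prems(2) by (metis real_sqrt_le_mono real_sqrt_mult real_sqrt_abs abs_of_nonneg)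
    then show ?thesis
      using less.prems(3)[OF T] \<open>0 \<le> c\<close> by (meson mult_left_mono order_trans)
  qed
  show ?case
  proof (cases "card A \<le> m")
    case True
    have "0 \<le> (\<Sum>j\<in>A. \<bar>u j\<bar>) / sqrt m" by (simp add: sum_nonneg)
    then have "c * (sqrt m * B) \<le> c * (sqrt m * B + (\<Sum>j\<in>A. \<bar>u j\<bar>) / sqrt m)"
      using \<open>0 \<le> c\<close> by (intro mult_left_mono) auto
    then show ?thesis using head[OF order_refl True] by simp
  next
    case False
    obtain T where T: "T \<subseteq> A" "card T = m" "\<forall>i\<in>T. \<forall>j\<in>A - T. \<bar>u j\<bar> \<le> \<bar>u i\<bar>"
      using top_subset[OF less.prems(1), of m "\<lambda>j. \<bar>u j\<bar>"] False by auto
    have finT: "finite T" using less.prems(1) T(1) by (rule finite_subset[rotated])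
    define B' where "B' = (\<Sum>j\<in>T. \<bar>u j\<bar>) / m"
    have B': "\<bar>u j\<bar> \<le> B'" if "j \<in> A - T" for j
    proof -
      have "(\<Sum>i\<in>T. \<bar>u j\<bar>) \<le> (\<Sum>i\<in>T. \<bar>u i\<bar>)" using T(3) that by (intro sum_mono) auto
      then show ?thesis using T(2) \<open>0 < m\<close> by (simp add: B'_def field_simps)
    qed
    have "card (A - T) < card A"
      using T(1,2) \<open>0 < m\<close> less.prems(1) False by (simp add: card_Diff_subset[OF finT T(1)])
    then have IH: "\<bar>\<Sum>j\<in>A - T. \<phi> j\<bar> \<le> c * (sqrt m * B' + (\<Sum>j\<in>A - T. \<bar>u j\<bar>) / sqrt m)"
      using less.prems B' by (intro less.hyps) (auto simp: B'_def sum_nonneg)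
    have split: "(\<Sum>j\<in>A. f j) = (\<Sum>j\<in>T. f j) + (\<Sum>j\<in>A - T. f j)" for f :: "'a \<Rightarrow> real"
      using sum.subset_diff[OF T(1) less.prems(1), of f] by simp
    have sB: "sqrt m * B' = (\<Sum>j\<in>T. \<bar>u j\<bar>) / sqrt m"
      using \<open>0 < m\<close> by (simp add: B'_def field_simps)
    have "\<bar>\<Sum>j\<in>A. \<phi> j\<bar> \<le> c * (sqrt m * B) + c * (sqrt m * B' + (\<Sum>j\<in>A - T. \<bar>u j\<bar>) / sqrt m)"
      unfolding split[of \<phi>] using head[OF T(1)] T(2) IH by linarith
    also have "\<dots> = c * (sqrt m * B + (\<Sum>j\<in>A. \<bar>u j\<bar>) / sqrt m)"
      unfolding sB split[of "\<lambda>j. \<bar>u j\<bar>"] by (simp add: algebra_simps add_divide_distrib)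
    finally show ?thesis .
  qed
qed

lemma sum_abs_le_sqrt_card:
  fixes f :: "'a \<Rightarrow> real"
  shows "(\<Sum>j\<in>T. \<bar>f j\<bar>) \<le> sqrt (card T) * sqrt (\<Sum>j\<in>T. (f j)\<^sup>2)"
proof -
  have "(\<Sum>j\<in>T. \<bar>f j\<bar>) = (\<Sum>j\<in>T. \<bar>1\<bar> * \<bar>f j\<bar>)" by simp
  also have "\<dots> \<le> L2_set (\<lambda>_. 1) T * L2_set f T" by (rule L2_set_mult_ineq)
  finally show ?thesis by (simp add: L2_set_def)
qed

section \<open>Restriction, norms and the Gram form\<close>

definition restrict_vec :: "'p set \<Rightarrow> real ^ 'p \<Rightarrow> real ^ 'p"
  where "restrict_vec T v = (\<chi> j. if j \<in> T then v $ j else 0)"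

lemma restrict_vec_nth [simp]: "restrict_vec T v $ j = (if j \<in> T then v $ j else 0)"
  by (simp add: restrict_vec_def)

lemma supp_restrict_vec: "supp (restrict_vec T v) \<subseteq> T"
  by (auto simp: supp_def)

lemma card_supp_restrict_vec: "card (supp (restrict_vec T v)) \<le> card T"
  for T :: "'p::finite set"
  by (rule card_mono[OF finite supp_restrict_vec])

lemma norm_restrict_vec: "(norm (restrict_vec T v))\<^sup>2 = (\<Sum>j\<in>T. (v $ j)\<^sup>2)"
  by (simp add: norm_vec_def L2_set_def sum_nonneg if_distrib[of "\<lambda>x. x\<^sup>2"] sum.If_cases cong: if_cong)

lemma norm_vec_square: "(norm (v :: real ^ 'p))\<^sup>2 = (\<Sum>j\<in>UNIV. (v $ j)\<^sup>2)"
  by (simp add: norm_vec_def L2_set_def sum_nonneg)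

lemma l1_norm_triangle: "l1_norm (v + w) \<le> l1_norm v + l1_norm w"
  unfolding l1_norm_def sum.distrib[symmetric] by (intro sum_mono) (simp add: abs_triangle_ineq)

lemma l1_norm_scaled_axis: "l1_norm (t *\<^sub>R axis j 1) = \<bar>t\<bar>"
  by (simp add: l1_norm_def axis_def if_distrib[of abs] if_distrib[of "\<lambda>x. t * x"] cong: if_cong)

lemma norm_le_l1_norm: "norm v \<le> l1_norm v"
  unfolding l1_norm_def by (rule norm_le_l1_cart)

lemma l1_norm_split: "l1_norm v = (\<Sum>j\<in>T. \<bar>v $ j\<bar>) + (\<Sum>j\<in>-T. \<bar>v $ j\<bar>)"
  for T :: "'p::finite set"
  unfolding l1_norm_def using sum.subset_diff[of T UNIV "\<lambda>j. \<bar>v $ j\<bar>"] by (simp add: Compl_eq_Diff_UNIV)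

lemma l1_norm_le_sqrt_card:
  fixes T :: "'p::finite set"
  assumes "supp v \<subseteq> T"
  shows "l1_norm v \<le> sqrt (card T) * norm v"
proof -
  have "(\<Sum>j\<in>-T. \<bar>v $ j\<bar>) = 0" using assms by (intro sum.neutral) (auto simp: supp_def)
  then have "l1_norm v \<le> sqrt (card T) * sqrt (\<Sum>j\<in>T. (v $ j)\<^sup>2)"
    unfolding l1_norm_split[of v T] by (simp add: sum_abs_le_sqrt_card)
  also have "\<dots> \<le> sqrt (card T) * norm v"
    by (intro mult_left_mono) (auto simp: norm_vec_def L2_set_def intro!: sum_mono2)
  finally show ?thesis .
qed

lemma infnorm_le_iff: "infnorm (v :: real ^ 'p) \<le> l \<longleftrightarrow> (\<forall>j. \<bar>v $ j\<bar> \<le> l)"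
proof -
  have eq: "infnorm v = Max (range (\<lambda>j. \<bar>v $ j\<bar>))"
    by (simp add: infnorm_cart cSup_eq_Max full_SetCompr_eq)
  show ?thesis unfolding eq by (subst Max_le_iff) auto
qed

text \<open>
  The bilinear form of the normalised Gram matrix.
\<close>

definition gram :: "real ^ 'p ^ 'n \<Rightarrow> real ^ 'p \<Rightarrow> real ^ 'p \<Rightarrow> real"
  where "gram X v w = ((X *v v) \<bullet> (X *v w)) / real CARD('n)"

lemma gram_simps:
  "gram X (v + v') w = gram X v w + gram X v' w"
  "gram X (v - v') w = gram X v w - gram X v' w"
  "gram X (c *\<^sub>R v) w = c * gram X v w"
  "gram X v (w + w') = gram X v w + gram X v w'"
  "gram X v (w - w') = gram X v w - gram X v w'"
  "gram X v (c *\<^sub>R w) = c * gram X v w"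
  "gram X 0 w = 0" "gram X v 0 = 0"
  by (simp_all add: gram_def inner_simps matrix_vector_right_distrib matrix_vector_mult_diff_distrib
      matrix_vector_mult_scaleR add_divide_distrib diff_divide_distrib)

lemma gram_commute: "gram X v w = gram X w v"
  by (simp add: gram_def inner_commute)

lemma gram_self: "gram X v v = (norm (X *v v))\<^sup>2 / real CARD('n)"
  for X :: "real ^ 'p ^ 'n"
  by (simp add: gram_def power2_norm_eq_inner)

lemma gram_nonneg: "0 \<le> gram X v v"
  by (simp add: gram_def)

lemma gram_expand:
  "gram X (e - t *\<^sub>R w) (e - t *\<^sub>R w) = gram X e e - 2 * t * gram X w e + t\<^sup>2 * gram X w w"
  using gram_commute[of X e w] by (simp add: gram_simps algebra_simps power2_eq_square)

lemma gram_sum_left: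
  "gram X v w = (\<Sum>j\<in>UNIV. v $ j * gram X (axis j 1) w)"
proof -
  have "v = (\<Sum>j\<in>UNIV. v $ j *\<^sub>R axis j 1)"
    using basis_expansion[of v] by (simp add: scalar_mult_eq_scaleR)
  then have "X *v v = (\<Sum>j\<in>UNIV. v $ j *\<^sub>R (X *v axis j 1))"
    by (metis (no_types, lifting) linear_sum matrix_vector_mul_linear matrix_vector_mult_scaleR sum.cong)
  then show ?thesis
    by (simp add: gram_def inner_sum_left sum_divide_distrib)
qed

lemma gram_restrict_right:
  "gram X v (restrict_vec T w) = (\<Sum>j\<in>T. w $ j * gram X v (axis j 1))"
proof -
  have "gram X v (restrict_vec T w) = (\<Sum>j\<in>UNIV. (restrict_vec T w) $ j * gram X (axis j 1) v)"
    by (subst gram_commute) (rule gram_sum_left)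
  also have "\<dots> = (\<Sum>j\<in>T. w $ j * gram X v (axis j 1))"
    by (rule sum.mono_neutral_cong_right) (auto simp: gram_commute)
  finally show ?thesis .
qed

lemma gram_le_l1:
  fixes X :: "real ^ 'p ^ 'n"
  assumes "\<And>j. \<bar>gram X (axis j 1) w\<bar> \<le> l"
  shows "\<bar>gram X v w\<bar> \<le> l * l1_norm v"
proof -
  have "\<bar>gram X v w\<bar> \<le> (\<Sum>j\<in>UNIV. \<bar>v $ j\<bar> * l)"
    unfolding gram_sum_left[of X v w]
    by (rule order_trans[OF sum_abs]) (auto simp: abs_mult intro!: sum_mono mult_left_mono assms)
  then show ?thesis by (simp add: l1_norm_def sum_distrib_left mult.commute)
qed

lemma gram_Cauchy_Schwarz: "\<bar>gram X v w\<bar> \<le> sqrt (gram X v v) * sqrt (gram X w w)"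
  for X :: "real ^ 'p ^ 'n"
proof -
  have "\<bar>(X *v v) \<bullet> (X *v w)\<bar> \<le> norm (X *v v) * norm (X *v w)" by (rule Cauchy_Schwarz_ineq2)
  then show ?thesis
    unfolding gram_self by (simp add: gram_def real_sqrt_divide divide_right_mono)
qed

lemma cols_mult: "supp v \<subseteq> T \<Longrightarrow> cols T X *v v = X *v v"
  by (auto simp: cols_def supp_def matrix_vector_mult_def vec_eq_iff intro!: sum.cong)

lemma column_as_mult: "column j X = X *v axis j (1::real)"
  by (simp add: matrix_vector_mul_component column_def vec_eq_iff matrix_vector_mult_def axis_def
      if_distrib cong: if_cong)

lemma gram_axis: "gram X (axis j 1) v = (column j X \<bullet> (X *v v)) / real CARD('n)"
  for X :: "real ^ 'p ^ 'n"
  by (simp add: gram_def column_as_mult)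

lemma inner_column_mult:
  fixes X :: "real ^ 'p ^ 'n"
  shows "column i X \<bullet> (X *v x) = (\<Sum>k\<in>UNIV. (column i X \<bullet> column k X) * x $ k)"
  unfolding matrix_mult_sum[of X x] by (simp add: inner_sum_right scalar_mult_eq_scaleR mult.commute)

lemma correlation_nth:
  fixes X :: "real ^ 'p ^ 'n"
  shows "((1 / real CARD('n)) *\<^sub>R (transpose X *v z)) $ j = (column j X \<bullet> z) / real CARD('n)"
  by (simp add: matrix_vector_mult_def transpose_def column_def inner_vec_def)

lemma dantzig_feasible_iff:
  fixes X :: "real ^ 'p ^ 'n"
  shows "dantzig_feasible X Y l b \<longleftrightarrow> (\<forall>j. \<bar>column j X \<bullet> (Y - X *v b)\<bar> / real CARD('n) \<le> l)"
  by (simp only: dantzig_feasible_def infnorm_le_iff correlation_nth abs_divide abs_of_nat)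

section \<open>Restricted isometry and orthogonality\<close>

text \<open>
  The restricted isometry and orthogonality constants are least real numbers with a closed
  property, so the infimum has the property as well.
\<close>

lemma real_LeastI:
  fixes P :: "real \<Rightarrow> bool"
  assumes "P d0" and lower: "\<And>d. P d \<Longrightarrow> 0 \<le> d" and "closed (Collect P)"
  shows "P (LEAST d. P d)" and "0 \<le> (LEAST d. P d)"
proof -
  have bdd: "bdd_below (Collect P)" using lower by (intro bdd_belowI[of _ 0]) auto
  have "Inf (Collect P) \<in> Collect P"
    using assms bdd by (intro closed_contains_Inf) auto
  then have P: "P (Inf (Collect P))" by simp
  moreover have "Inf (Collect P) \<le> d" if "P d" for d
    using that bdd by (intro cInf_lower) auto
  ultimately have "(LEAST d. P d) = Inf (Collect P)" by (intro Least_equality) auto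
  with P show "P (LEAST d. P d)" by simp
  then show "0 \<le> (LEAST d. P d)" by (rule lower)
qed

lemma matrix_bounded: "\<exists>K. \<forall>v. norm (X *v v) \<le> K * norm v"
  for X :: "real ^ 'p ^ 'n"
  using bounded_linear.bounded[of "(*v) X"] matrix_vector_mul_bounded_linear[of X]
  by (metis mult.commute)

text \<open>
  Normalised columns force \<open>\<delta> \<ge> 0\<close>: the form is \<open>1\<close> on every coordinate vector.
\<close>

lemma restricted_isometry_attained:
  fixes X :: "real ^ 'p ^ 'n"
  assumes unit: "\<forall>j. norm (column j X) = sqrt (real CARD('n))" and "1 \<le> m"
  defines "\<delta> \<equiv> restricted_isometry X m"
  shows "card (supp v) \<le> m \<Longrightarrow> (1 - \<delta>) * (norm v)\<^sup>2 \<le> gram X v v \<and> gram X v v \<le> (1 + \<delta>) * (norm v)\<^sup>2"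
    and "0 \<le> \<delta>"
proof -
  define P where "P d \<longleftrightarrow> (\<forall>T (v :: real ^ 'p). card T \<le> m \<and> supp v \<subseteq> T \<longrightarrow>
       (1 - d) * (norm v)\<^sup>2 \<le> (norm (cols T X *v v))\<^sup>2 / real CARD('n) \<and>
       (norm (cols T X *v v))\<^sup>2 / real CARD('n) \<le> (1 + d) * (norm v)\<^sup>2)" for d
  have P_gram: "P d \<longleftrightarrow> (\<forall>T v. card T \<le> m \<and> supp v \<subseteq> T \<longrightarrow>
      (1 - d) * (norm v)\<^sup>2 \<le> gram X v v \<and> gram X v v \<le> (1 + d) * (norm v)\<^sup>2)" for d
    unfolding P_def by (simp add: cols_mult gram_self)
  have \<delta>: "\<delta> = (LEAST d. P d)" by (simp add: \<delta>_def restricted_isometry_def P_def)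
  obtain K where K: "\<And>v. norm (X *v v) \<le> K * norm v" using matrix_bounded by blast
  have ex: "P (1 + K\<^sup>2 / real CARD('n))"
    unfolding P_gram
  proof (intro allI impI conjI)
    fix T and v :: "real ^ 'p"
    have "gram X v v \<le> (K * norm v)\<^sup>2 / real CARD('n)"
      unfolding gram_self using K[of v] by (intro divide_right_mono power_mono) auto
    then show "gram X v v \<le> (1 + (1 + K\<^sup>2 / real CARD('n))) * (norm v)\<^sup>2"
      by (simp add: algebra_simps power_mult_distrib) (smt (verit) zero_le_power2)
    have "(1 - (1 + K\<^sup>2 / real CARD('n))) * (norm v)\<^sup>2 \<le> 0"
      by (simp add: mult_nonpos_nonneg)
    then show "(1 - (1 + K\<^sup>2 / real CARD('n))) * (norm v)\<^sup>2 \<le> gram X v v"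
      using gram_nonneg by (rule order_trans)
  qed
  have lower: "0 \<le> d" if "P d" for d
  proof -
    obtain j :: 'p where True by auto
    have "supp (axis j 1 :: real ^ 'p) \<subseteq> {j}" by (auto simp: supp_def axis_def)
    then have "(1 - d) * (norm (axis j 1 :: real ^ 'p))\<^sup>2 \<le> gram X (axis j 1) (axis j 1)"
      using that \<open>1 \<le> m\<close> unfolding P_gram by (metis card.empty card_insert_disjoint empty_iff finite.emptyI One_nat_def)
    moreover have "gram X (axis j 1) (axis j 1) = 1"
      using unit by (simp add: gram_self column_as_mult[symmetric])
    ultimately show ?thesis by simp
  qed
  have clos: "closed (Collect P)"
    unfolding P_def by (intro closed_Collect_all closed_Collect_imp closed_Collect_conj
        closed_Collect_le open_Collect_const continuous_intros)
  have "P \<delta>" "0 \<le> \<delta>" using real_LeastI[OF ex lower clos] by (simp_all add: \<delta>)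
  then show "0 \<le> \<delta>"
    and "card (supp v) \<le> m \<Longrightarrow> (1 - \<delta>) * (norm v)\<^sup>2 \<le> gram X v v \<and> gram X v v \<le> (1 + \<delta>) * (norm v)\<^sup>2"
    by (auto simp: P_gram)
qed

text \<open>
  Two distinct coordinate vectors force \<open>\<theta> \<ge> 0\<close>.
\<close>

lemma restricted_orthogonality_attained:
  fixes X :: "real ^ 'p ^ 'n"
  assumes "2 \<le> CARD('p)" and "1 \<le> m" and "1 \<le> m'"
  defines "\<theta> \<equiv> restricted_orthogonality X m m'"
  shows "\<lbrakk>supp v \<inter> supp w = {}; card (supp v) \<le> m; card (supp w) \<le> m'\<rbrakk>
      \<Longrightarrow> \<bar>gram X v w\<bar> \<le> \<theta> * norm v * norm w"
    and "0 \<le> \<theta>"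
proof -
  define P where "P c \<longleftrightarrow> (\<forall>T T' (v :: real ^ 'p) v'. T \<inter> T' = {} \<and> card T \<le> m \<and> card T' \<le> m' \<and>
         supp v \<subseteq> T \<and> supp v' \<subseteq> T' \<longrightarrow>
       \<bar>(cols T X *v v) \<bullet> (cols T' X *v v')\<bar> / real CARD('n) \<le> c * norm v * norm v')" for c
  have P_gram: "P c \<longleftrightarrow> (\<forall>T T' v v'. T \<inter> T' = {} \<and> card T \<le> m \<and> card T' \<le> m' \<and>
         supp v \<subseteq> T \<and> supp v' \<subseteq> T' \<longrightarrow> \<bar>gram X v v'\<bar> \<le> c * norm v * norm v')" for c
    unfolding P_def by (simp add: cols_mult gram_def)
  have \<theta>: "\<theta> = (LEAST c. P c)" by (simp add: \<theta>_def restricted_orthogonality_def P_def)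
  obtain K where K: "\<And>v. norm (X *v v) \<le> K * norm v" using matrix_bounded by blast
  have ex: "P (K\<^sup>2 / real CARD('n))"
    unfolding P_gram
  proof (intro allI impI conjI)
    fix T T' and v w :: "real ^ 'p"
    have "\<bar>(X *v v) \<bullet> (X *v w)\<bar> \<le> norm (X *v v) * norm (X *v w)" by (rule Cauchy_Schwarz_ineq2)
    also have "\<dots> \<le> (K * norm v) * (K * norm w)"
      using K by (meson mult_mono norm_ge_zero order_trans)
    finally show "\<bar>gram X v w\<bar> \<le> K\<^sup>2 / real CARD('n) * norm v * norm w"
      by (simp add: gram_def divide_right_mono power2_eq_square mult_ac)
  qed
  have lower: "0 \<le> c" if "P c" for c
  proof -
    obtain i j :: 'p where ij: "i \<noteq> j"
      using assms(1) by (metis (full_types) One_nat_def UNIV_I card_1_singleton_iff card_le_Suc0_iff_eq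
          finite not_less_eq_eq numeral_2_eq_2)
    have "{i} \<inter> {j} = {}" "card {i} \<le> m" "card {j} \<le> m'"
      "supp (axis i 1 :: real ^ 'p) \<subseteq> {i}" "supp (axis j 1 :: real ^ 'p) \<subseteq> {j}"
      using ij assms(2,3) by (auto simp: supp_def axis_def)
    then have "\<bar>gram X (axis i 1) (axis j 1)\<bar>
        \<le> c * norm (axis i 1 :: real ^ 'p) * norm (axis j 1 :: real ^ 'p)"
      using that unfolding P_gram by blast
    then show ?thesis by simp
  qed
  have clos: "closed (Collect P)"
    unfolding P_def by (intro closed_Collect_all closed_Collect_imp closed_Collect_conj
        closed_Collect_le open_Collect_const continuous_intros)
  have "P \<theta>" "0 \<le> \<theta>" using real_LeastI[OF ex lower clos] by (simp_all add: \<theta>)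
  then show "0 \<le> \<theta>" by simp
  show "\<lbrakk>supp v \<inter> supp w = {}; card (supp v) \<le> m; card (supp w) \<le> m'\<rbrakk>
      \<Longrightarrow> \<bar>gram X v w\<bar> \<le> \<theta> * norm v * norm w"
    using \<open>P \<theta>\<close> unfolding P_gram by blast
qed

text \<open>
  The pair \<open>s\<close>, \<open>2 s\<close> of sparsity levels is the one at which \<open>\<delta>\<close> and \<open>\<theta>\<close> are taken throughout:
  a head \<open>T0\<close> together with the next block after it is a set of at most \<open>2 s\<close> indices, and the
  remaining blocks have at most \<open>s\<close>.
\<close>

locale restricted_design =
  fixes X :: "real ^ 'p ^ 'n" and s :: nat and \<delta> \<theta> :: real
  assumes isometry_lower: "card (supp v) \<le> 2 * s \<Longrightarrow> (1 - \<delta>) * (norm v)\<^sup>2 \<le> gram X v v"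
    and isometry_upper: "card (supp v) \<le> 2 * s \<Longrightarrow> gram X v v \<le> (1 + \<delta>) * (norm v)\<^sup>2"
    and orthogonality: "\<lbrakk>supp v \<inter> supp w = {}; card (supp v) \<le> s; card (supp w) \<le> 2 * s\<rbrakk>
      \<Longrightarrow> \<bar>gram X v w\<bar> \<le> \<theta> * norm v * norm w"
    and \<delta>_nonneg: "0 \<le> \<delta>" and \<theta>_nonneg: "0 \<le> \<theta>" and gap: "\<delta> + \<theta> < 1"

section \<open>The noiseless Lasso\<close>

text \<open>
  A minimiser of the noiseless Lasso functional. The first property is stationarity in the
  coordinate directions, the second compares the minimum with the value at \<open>0\<close>. Together they
  say that \<open>\<beta>\<close> can be exchanged for a vector of small \<open>\<ell>\<^sub>1\<close> norm without changing any correlation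
  by more than \<open>\<nu>\<close>.
\<close>

lemma lasso_approximation:
  fixes X :: "real ^ 'p ^ 'n" and \<beta> :: "real ^ 'p"
  assumes "0 < \<nu>"
  shows "\<exists>b. (\<forall>j. \<bar>gram X (axis j 1) (\<beta> - b)\<bar> \<le> \<nu>) \<and> \<nu> * l1_norm b \<le> gram X \<beta> \<beta> / 2"
proof -
  define f where "f b = gram X (\<beta> - b) (\<beta> - b) / 2 + \<nu> * l1_norm b" for b
  have f0: "f 0 = gram X \<beta> \<beta> / 2" by (simp add: f_def l1_norm_def)
  have "continuous_on UNIV (\<lambda>b. X *v (\<beta> - b))"
    by (rule bounded_linear.continuous_on[OF matrix_vector_mul_bounded_linear])
      (intro continuous_intros)
  then have cont: "continuous_on UNIV f"
    unfolding f_def gram_def l1_norm_def by (intro continuous_intros) auto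
  obtain b where b: "b \<in> cball 0 (f 0 / \<nu>)" "\<And>x. x \<in> cball 0 (f 0 / \<nu>) \<Longrightarrow> f b \<le> f x"
  proof -
    have "0 \<le> f 0 / \<nu>" using assms by (simp add: f0 gram_nonneg)
    then show thesis
      using continuous_attains_inf[of "cball 0 (f 0 / \<nu>)" f] that continuous_on_subset[OF cont]
      by auto
  qed
  \<comment> \<open>Outside this ball the penalty alone exceeds \<open>f 0\<close>.\<close>
  have glob: "f b \<le> f x" for x
  proof (cases "x \<in> cball 0 (f 0 / \<nu>)")
    case False
    have "f 0 < \<nu> * norm x" using False assms by (simp add: field_simps)
    also have "\<dots> \<le> \<nu> * l1_norm x" using assms norm_le_l1_norm by (intro mult_left_mono) auto
    also have "\<dots> \<le> f x" by (simp add: f_def gram_nonneg)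
    finally have "f 0 < f x" .
    moreover have "f b \<le> f 0" using b(2)[of 0] assms by (simp add: f0 gram_nonneg)
    ultimately show ?thesis by simp
  qed (use b in auto)
  have "\<bar>gram X (axis j 1) (\<beta> - b)\<bar> \<le> \<nu>" for j
  proof (rule ccontr)
    define g where "g = gram X (axis j 1) (\<beta> - b)"
    define q where "q = gram X (axis j 1) (axis j 1)"
    assume "\<not> \<bar>gram X (axis j 1) (\<beta> - b)\<bar> \<le> \<nu>"
    then have gt: "0 < \<bar>g\<bar> - \<nu>" by (simp add: g_def)
    have q: "0 \<le> q" by (simp add: q_def gram_nonneg)
    \<comment> \<open>A step of length \<open>r\<close> along the coordinate \<open>j\<close> changes \<open>f\<close> by at most
      \<open>r\<^sup>2 q / 2 - r (\<bar>g\<bar> - \<nu>)\<close>; this \<open>r\<close> is short enough for the linear term to win.\<close>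
    define r where "r = (\<bar>g\<bar> - \<nu>) / (q + 1)"
    have r: "0 < r" using gt q by (simp add: r_def)
    define t where "t = sgn g * r"
    have g0: "g \<noteq> 0" using gt assms by auto
    have t: "t * g = r * \<bar>g\<bar>" "\<bar>t\<bar> = r" "t\<^sup>2 = r\<^sup>2"
      using r g0 by (auto simp: t_def abs_mult sgn_if power_mult_distrib)
    have quad: "gram X (\<beta> - (b + t *\<^sub>R axis j 1)) (\<beta> - (b + t *\<^sub>R axis j 1))
        = gram X (\<beta> - b) (\<beta> - b) - 2 * t * g + t\<^sup>2 * q"
      using gram_expand[of X "\<beta> - b" t "axis j 1"] by (simp add: g_def q_def diff_diff_add)
    have "f (b + t *\<^sub>R axis j 1) \<le> (gram X (\<beta> - b) (\<beta> - b) - 2 * t * g + t\<^sup>2 * q) / 2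
        + \<nu> * (l1_norm b + \<bar>t\<bar>)"
      unfolding f_def quad using assms l1_norm_triangle[of b "t *\<^sub>R axis j 1"]
      by (simp add: l1_norm_scaled_axis)
    also have "\<dots> = f b + r * (r * q / 2 - (\<bar>g\<bar> - \<nu>))"
      using t by (simp add: f_def field_simps power2_eq_square)
    finally have "0 \<le> r * (r * q / 2 - (\<bar>g\<bar> - \<nu>))" using glob[of "b + t *\<^sub>R axis j 1"] by simp
    then have "\<bar>g\<bar> - \<nu> \<le> r * q / 2" using r by (simp add: zero_le_mult_iff)
    moreover have "r * (q + 1) = \<bar>g\<bar> - \<nu>" using q by (simp add: r_def)
    moreover have "0 \<le> r * q" using r q by simp
    ultimately show False using r by (simp add: algebra_simps)
  qed
  moreover have "\<nu> * l1_norm b \<le> f b" by (simp add: f_def gram_nonneg)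
  then have "\<nu> * l1_norm b \<le> gram X \<beta> \<beta> / 2" using glob[of 0] by (simp add: f0)
  ultimately show ?thesis by auto
qed

section \<open>Error of the Dantzig solution\<close>

context restricted_design
begin

text \<open>
  \<open>T1\<close> consists of the \<open>k\<close> largest entries of \<open>u\<close> off \<open>T0\<close>. Restricted isometry applies to
  \<open>v = u\<close> on \<open>T0 \<union> T1\<close>, and \<open>v\<^sup>T G v\<close> differs from \<open>v\<^sup>T G u\<close> by the pairing of \<open>v\<close> with the tail of
  \<open>u\<close>, to which \<open>block_sum_bound\<close> applies with \<open>T1\<close> as the block preceding the tail.
\<close>

lemma head_estimate:
  assumes "card T0 = k" and "1 \<le> k" and "k \<le> s"
  shows "\<exists>T1. T0 \<inter> T1 = {} \<and> card T1 \<le> k \<and>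
    (1 - \<delta>) * (norm (restrict_vec (T0 \<union> T1) u))\<^sup>2 \<le> gram X (restrict_vec (T0 \<union> T1) u) u
      + \<theta> * norm (restrict_vec (T0 \<union> T1) u) * ((\<Sum>j\<in>-T0. \<bar>u $ j\<bar>) / sqrt k)"
proof -
  define k' where "k' = min k (card (- T0))"
  obtain T1 where T1: "T1 \<subseteq> -T0" "card T1 = k'" "\<forall>i\<in>T1. \<forall>j\<in>-T0 - T1. \<bar>u $ j\<bar> \<le> \<bar>u $ i\<bar>"
    using top_subset[of "- T0" k' "\<lambda>j. \<bar>u $ j\<bar>"] by (auto simp: k'_def)
  define A where "A = - T0 - T1"
  define v where "v = restrict_vec (T0 \<union> T1) u"
  define B where "B = (\<Sum>j\<in>T1. \<bar>u $ j\<bar>) / k"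
  have card2: "card (T0 \<union> T1) \<le> 2 * s"
    using card_Un_le[of T0 T1] T1(2) assms by (simp add: k'_def)
  have card_v: "card (supp v) \<le> 2 * s"
    unfolding v_def using card_supp_restrict_vec card2 by (rule order_trans)
  \<comment> \<open>If fewer than \<open>k\<close> indices are left off \<open>T0\<close>, then \<open>T1\<close> takes all of them and \<open>A\<close> is empty.\<close>
  have B: "\<bar>u $ j\<bar> \<le> B" if "j \<in> A" for j
  proof -
    have "T1 \<noteq> - T0" using that by (auto simp: A_def)
    then have "card T1 = k" using T1(1,2) psubset_card_mono[of "- T0" T1]
      by (auto simp: k'_def psubset_eq min_def split: if_splits)
    moreover have "(\<Sum>i\<in>T1. \<bar>u $ j\<bar>) \<le> (\<Sum>i\<in>T1. \<bar>u $ i\<bar>)"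
      using T1(3) that by (intro sum_mono) (auto simp: A_def)
    ultimately show ?thesis using assms(2) by (simp add: B_def field_simps)
  qed
  have "\<bar>\<Sum>j\<in>A. u $ j * gram X v (axis j 1)\<bar>
      \<le> (\<theta> * norm v) * (sqrt k * B + (\<Sum>j\<in>A. \<bar>u $ j\<bar>) / sqrt k)"
  proof (rule block_sum_bound)
    fix T assume T: "T \<subseteq> A" "card T \<le> k"
    have "supp (restrict_vec T u) \<inter> supp v = {}"
      using supp_restrict_vec[of T u] supp_restrict_vec[of "T0 \<union> T1" u] T(1)
      by (auto simp: v_def A_def)
    moreover have "card (supp (restrict_vec T u)) \<le> s"
      using card_supp_restrict_vec[of T u] T(2) assms(3) by simp
    ultimately have "\<bar>gram X (restrict_vec T u) v\<bar> \<le> \<theta> * norm (restrict_vec T u) * norm v"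
      using card_v by (intro orthogonality)
    moreover have "norm (restrict_vec T u) = sqrt (\<Sum>j\<in>T. (u $ j)\<^sup>2)"
      by (metis norm_restrict_vec norm_ge_zero real_sqrt_unique)
    ultimately show "\<bar>\<Sum>j\<in>T. u $ j * gram X v (axis j 1)\<bar> \<le> \<theta> * norm v * sqrt (\<Sum>j\<in>T. (u $ j)\<^sup>2)"
      using gram_restrict_right[of X v T u] gram_commute[of X v "restrict_vec T u"]
      by (simp add: mult_ac)
  qed (use assms(2) B \<theta>_nonneg in \<open>auto simp: B_def sum_nonneg\<close>)
  also have "sqrt k * B + (\<Sum>j\<in>A. \<bar>u $ j\<bar>) / sqrt k = (\<Sum>j\<in>-T0. \<bar>u $ j\<bar>) / sqrt k"
  proof -
    have "sqrt k * B = (\<Sum>j\<in>T1. \<bar>u $ j\<bar>) / sqrt k"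
      using assms(2) by (simp add: B_def field_simps)
    then show ?thesis
      using sum.subset_diff[OF T1(1), of "\<lambda>j. \<bar>u $ j\<bar>"] by (simp add: A_def add_divide_distrib)
  qed
  finally have tail: "\<bar>gram X v (restrict_vec A u)\<bar> \<le> \<theta> * norm v * ((\<Sum>j\<in>-T0. \<bar>u $ j\<bar>) / sqrt k)"
    by (simp add: gram_restrict_right)
  have "u = v + restrict_vec A u" by (auto simp: vec_eq_iff v_def A_def)
  then have "gram X v u = gram X v v + gram X v (restrict_vec A u)" by (metis gram_simps(4))
  then have "(1 - \<delta>) * (norm v)\<^sup>2 \<le> gram X v u + \<theta> * norm v * ((\<Sum>j\<in>-T0. \<bar>u $ j\<bar>) / sqrt k)"
    using isometry_lower[OF card_v] tail by linarith
  then show ?thesis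
    using T1 by (intro exI[of _ T1]) (auto simp: v_def k'_def)
qed

text \<open>
  The hypothesis \<open>optimal\<close> is what feasibility of \<open>\<beta>1 + b\<close> gives for a Dantzig solution. The
  unknowns are \<open>H = \<parallel>u\<parallel>\<^sub>2\<close> on \<open>T0\<close> and \<open>V = \<parallel>u\<parallel>\<^sub>1\<close> off \<open>T0\<close> for \<open>u = init - \<beta>1\<close>. Minimality
  bounds \<open>V\<close> by \<open>sqrt k H\<close> up to \<open>\<parallel>b\<parallel>\<^sub>1\<close>, and \<open>head_estimate\<close> bounds \<open>(1 - \<delta>) H\<close> by
  \<open>\<theta> V / sqrt k\<close> up to terms of order \<open>l sqrt k\<close>; as \<open>\<delta> + \<theta> < 1\<close>, the two inequalities can be
  solved. It matters that \<open>u\<close> is the difference to \<open>\<beta>1\<close> and not to \<open>\<beta>1 + b\<close>: on \<open>T0\<close> it is the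
  estimation error and off \<open>T0\<close> it is the estimate, the two quantities that thresholding needs.
\<close>

lemma dantzig_head_tail:
  fixes \<beta>1 \<beta>2 init :: "real ^ 'p" and \<mu> \<nu> l :: real
  assumes T0: "card T0 = k" "1 \<le> k" "k \<le> s"
    and \<beta>1: "supp \<beta>1 \<subseteq> T0"
    and \<beta>2: "card (supp \<beta>2) \<le> s" "(norm \<beta>2)\<^sup>2 \<le> k * \<mu>\<^sup>2"
    and \<mu>: "0 < \<mu>" "\<mu> \<le> \<nu>" "\<mu> \<le> l"
    and optimal: "\<And>b. (\<And>j. \<bar>gram X (axis j 1) (\<beta>2 - b)\<bar> \<le> \<nu>) \<Longrightarrow> l1_norm init \<le> l1_norm (\<beta>1 + b)"
    and residual: "\<And>j. \<bar>gram X (axis j 1) (init - (\<beta>1 + \<beta>2))\<bar> \<le> 2 * l"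
  defines "K \<equiv> (2 * sqrt 2 + (1 + \<delta>) + \<theta> * (1 + \<delta>) / 2) / (1 - \<delta> - \<theta>)"
  shows "norm (restrict_vec T0 (init - \<beta>1)) \<le> K * l * sqrt k"
    and "(\<Sum>j\<in>-T0. \<bar>init $ j\<bar>) \<le> (K + (1 + \<delta>) / 2) * l * k"
proof -
  define u where "u = init - \<beta>1"
  define H where "H = norm (restrict_vec T0 u)"
  define V where "V = (\<Sum>j\<in>-T0. \<bar>u $ j\<bar>)"
  have l: "0 < l" using \<mu> by simp
  have sk: "0 < sqrt k" "sqrt k * sqrt k = k" using T0(2) by auto
  have off: "(\<Sum>j\<in>-T0. \<bar>init $ j\<bar>) = V"
  proof -
    have "\<beta>1 $ j = 0" if "j \<notin> T0" for j using \<beta>1 that by (auto simp: supp_def)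
    then show ?thesis unfolding V_def by (intro sum.cong) (auto simp: u_def)
  qed

  have \<nu>: "0 < \<nu>" using \<mu> by simp
  obtain b where b: "\<And>j. \<bar>gram X (axis j 1) (\<beta>2 - b)\<bar> \<le> \<nu>" "\<nu> * l1_norm b \<le> gram X \<beta>2 \<beta>2 / 2"
    using lasso_approximation[OF \<nu>, of X \<beta>2] by blast
  have b_small: "l1_norm b \<le> (1 + \<delta>) / 2 * l * k"
  proof -
    have "l1_norm b \<ge> 0" by (simp add: l1_norm_def sum_nonneg)
    then have "\<mu> * l1_norm b \<le> \<nu> * l1_norm b" using \<mu> by (intro mult_right_mono) auto
    also have "\<dots> \<le> (1 + \<delta>) * (norm \<beta>2)\<^sup>2 / 2"
      using b(2) isometry_upper[of \<beta>2] \<beta>2(1) by simp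
    also have "\<dots> \<le> (1 + \<delta>) * (k * \<mu>\<^sup>2) / 2"
      using \<beta>2(2) \<delta>_nonneg by (intro divide_right_mono mult_left_mono) auto
    finally have "\<mu> * l1_norm b \<le> \<mu> * ((1 + \<delta>) / 2 * \<mu> * k)"
      by (simp add: power2_eq_square mult_ac)
    then have "l1_norm b \<le> (1 + \<delta>) / 2 * \<mu> * k" using \<mu> by simp
    also have "\<dots> \<le> (1 + \<delta>) / 2 * l * k"
      using \<mu> \<delta>_nonneg by (intro mult_right_mono mult_left_mono) auto
    finally show ?thesis .
  qed

  have cone: "V \<le> sqrt k * H + (1 + \<delta>) / 2 * l * k"
  proof -
    have "l1_norm init \<le> l1_norm \<beta>1 + l1_norm b"
      using optimal[OF b(1)] l1_norm_triangle[of \<beta>1 b] by simp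
    moreover have "l1_norm \<beta>1 = (\<Sum>j\<in>T0. \<bar>\<beta>1 $ j\<bar>)"
      using \<beta>1 unfolding l1_norm_split[of \<beta>1 T0] by (auto simp: supp_def intro!: sum.neutral)
    moreover have "(\<Sum>j\<in>T0. \<bar>\<beta>1 $ j\<bar>) - (\<Sum>j\<in>T0. \<bar>u $ j\<bar>) \<le> (\<Sum>j\<in>T0. \<bar>init $ j\<bar>)"
      unfolding sum_subtractf[symmetric] u_def by (intro sum_mono) auto
    moreover have "(\<Sum>j\<in>T0. \<bar>u $ j\<bar>) \<le> sqrt k * H"
    proof -
      have "H = sqrt (\<Sum>j\<in>T0. (u $ j)\<^sup>2)"
        unfolding H_def by (metis norm_restrict_vec norm_ge_zero real_sqrt_unique)
      then show ?thesis using sum_abs_le_sqrt_card[of "\<lambda>j. u $ j" T0] T0(1) by simp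
    qed
    ultimately show ?thesis using b_small off unfolding l1_norm_split[of init T0] by linarith
  qed

  obtain T1 where T1: "T0 \<inter> T1 = {}" "card T1 \<le> k"
    and est: "(1 - \<delta>) * (norm (restrict_vec (T0 \<union> T1) u))\<^sup>2 \<le> gram X (restrict_vec (T0 \<union> T1) u) u
      + \<theta> * norm (restrict_vec (T0 \<union> T1) u) * (V / sqrt k)"
    using head_estimate[OF T0, of u] unfolding V_def by blast
  define v where "v = restrict_vec (T0 \<union> T1) u"
  have card_T: "card (T0 \<union> T1) \<le> 2 * k" using card_Un_le[of T0 T1] T0(1) T1(2) by simp
  have H_le: "H \<le> norm v"
    unfolding H_def v_def norm_vec_def by (intro L2_set_mono) auto
  have g1: "gram X v (init - (\<beta>1 + \<beta>2)) \<le> norm v * (2 * sqrt 2 * l * sqrt k)"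
  proof -
    have "\<bar>gram X v (init - (\<beta>1 + \<beta>2))\<bar> \<le> 2 * l * l1_norm v" by (rule gram_le_l1[OF residual])
    also have "\<dots> \<le> 2 * l * (sqrt (card (T0 \<union> T1)) * norm v)"
      using l by (intro mult_left_mono l1_norm_le_sqrt_card) (auto simp: v_def supp_restrict_vec)
    also have "\<dots> \<le> 2 * l * (sqrt (2 * k) * norm v)"
      using l card_T by (intro mult_left_mono mult_right_mono real_sqrt_le_mono)
        (auto simp del: of_nat_mult simp: of_nat_mult[symmetric])
    finally show ?thesis by (simp add: real_sqrt_mult mult_ac)
  qed
  have g2: "gram X v \<beta>2 \<le> norm v * ((1 + \<delta>) * l * sqrt k)"
  proof -
    have cv: "card (supp v) \<le> 2 * s"
      using card_supp_restrict_vec[of "T0 \<union> T1" u] card_T T0(3) by (simp add: v_def)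
    have n2: "norm \<beta>2 \<le> l * sqrt k"
    proof -
      have "(norm \<beta>2)\<^sup>2 \<le> (l * sqrt k)\<^sup>2"
        using \<beta>2(2) power_mono[of \<mu> l 2] \<mu> mult_left_mono[of "\<mu>\<^sup>2" "l\<^sup>2" "real k"]
        by (simp add: power_mult_distrib mult.commute)
      then show ?thesis by (rule power2_le_imp_le) (use l in simp)
    qed
    have "\<bar>gram X v \<beta>2\<bar> \<le> sqrt (gram X v v) * sqrt (gram X \<beta>2 \<beta>2)" by (rule gram_Cauchy_Schwarz)
    also have "\<dots> \<le> sqrt ((1 + \<delta>) * (norm v)\<^sup>2) * sqrt ((1 + \<delta>) * (norm \<beta>2)\<^sup>2)"
      using isometry_upper[OF cv] isometry_upper[of \<beta>2] \<beta>2(1) gram_nonneg[of X] \<delta>_nonneg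
      by (intro mult_mono real_sqrt_le_mono) auto
    also have "\<dots> = (sqrt (1 + \<delta>) * sqrt (1 + \<delta>)) * norm v * norm \<beta>2"
      by (simp only: real_sqrt_mult real_sqrt_abs abs_norm_cancel mult_ac)
    also have "\<dots> = (1 + \<delta>) * norm v * norm \<beta>2"
      using \<delta>_nonneg by simp
    also have "\<dots> \<le> (1 + \<delta>) * norm v * (l * sqrt k)"
      using n2 \<delta>_nonneg by (intro mult_left_mono) auto
    finally show ?thesis by (simp add: mult_ac)
  qed
  \<comment> \<open>\<open>\<beta>2\<close> enters through its \<open>\<ell>\<^sub>2\<close> norm only, which is of order \<open>sqrt k\<close>.\<close>
  have "gram X v u = gram X v (init - (\<beta>1 + \<beta>2)) + gram X v \<beta>2"
    unfolding gram_simps(4)[symmetric] by (simp add: u_def)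
  with est g1 g2 have "(1 - \<delta>) * (norm v)\<^sup>2
      \<le> norm v * (2 * sqrt 2 * l * sqrt k) + norm v * ((1 + \<delta>) * l * sqrt k) + \<theta> * norm v * (V / sqrt k)"
    by (simp add: v_def)
  then have "norm v * ((1 - \<delta>) * norm v)
      \<le> norm v * (2 * sqrt 2 * l * sqrt k + (1 + \<delta>) * l * sqrt k + \<theta> * (V / sqrt k))"
    by (simp add: algebra_simps power2_eq_square)
  moreover have "0 \<le> V" by (simp add: V_def sum_nonneg)
  then have "0 \<le> 2 * sqrt 2 * l * sqrt k + (1 + \<delta>) * l * sqrt k + \<theta> * (V / sqrt k)"
    using l \<delta>_nonneg \<theta>_nonneg by simp
  ultimately have main: "(1 - \<delta>) * norm v
      \<le> 2 * sqrt 2 * l * sqrt k + (1 + \<delta>) * l * sqrt k + \<theta> * (V / sqrt k)"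
    by (cases "norm v = 0") (simp, metis mult_le_cancel_left_pos norm_ge_zero order_le_less)
  have "V / sqrt k \<le> norm v + (1 + \<delta>) / 2 * l * sqrt k"
  proof -
    have "V \<le> sqrt k * norm v + (1 + \<delta>) / 2 * l * (sqrt k * sqrt k)"
      using cone H_le mult_left_mono[OF H_le, of "sqrt k"] by simp
    then have "V \<le> (norm v + (1 + \<delta>) / 2 * l * sqrt k) * sqrt k" by (simp add: algebra_simps)
    then show ?thesis using sk(1) by (subst pos_divide_le_eq)
  qed
  then have "\<theta> * (V / sqrt k) \<le> \<theta> * (norm v + (1 + \<delta>) / 2 * l * sqrt k)"
    using \<theta>_nonneg by (rule mult_left_mono)
  with main have "(1 - \<delta> - \<theta>) * norm v \<le> (2 * sqrt 2 + (1 + \<delta>) + \<theta> * (1 + \<delta>) / 2) * l * sqrt k"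
    by (simp add: algebra_simps)
  then have "norm v \<le> K * l * sqrt k"
    using gap by (simp add: K_def pos_le_divide_eq mult.commute)
  with H_le have H: "H \<le> K * l * sqrt k" by simp
  then show "norm (restrict_vec T0 (init - \<beta>1)) \<le> K * l * sqrt k" by (simp add: H_def u_def)
  have "sqrt k * H \<le> K * l * k"
    using mult_left_mono[OF H, of "sqrt k"] sk by (simp add: mult_ac)
  with cone show "(\<Sum>j\<in>-T0. \<bar>init $ j\<bar>) \<le> (K + (1 + \<delta>) / 2) * l * k"
    unfolding off by (simp add: algebra_simps)
qed

end

section \<open>Essential sparsity\<close>

text \<open>
  More than \<open>k\<close> entries above \<open>\<mu>\<close> in absolute value would contribute at least \<open>(k + 1) \<mu>\<^sup>2\<close> to the truncated sum.
  Hence all entries off the \<open>k\<close> largest ones are at most \<open>\<mu>\<close>, and truncation does not change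
  their squares.
\<close>

lemma essential_sparsity_head:
  fixes \<beta> :: "real ^ 'p"
  assumes "0 < \<mu>" and "supp \<beta> \<noteq> {}"
  defines "k \<equiv> essential_sparsity \<mu> \<beta>"
  shows "1 \<le> k" and "k \<le> card (supp \<beta>)"
    and "\<exists>T0\<subseteq>supp \<beta>. card T0 = k \<and> (\<Sum>j\<in>-T0. (\<beta> $ j)\<^sup>2) \<le> k * \<mu>\<^sup>2"
proof -
  define \<Phi> where "\<Phi> = (\<Sum>j\<in>UNIV. min ((\<beta> $ j)\<^sup>2) (\<mu>\<^sup>2))"
  have k: "k = (LEAST k. \<Phi> \<le> real k * \<mu>\<^sup>2)"
    by (simp add: k_def essential_sparsity_def \<Phi>_def)
  have partial: "(\<Sum>j\<in>T. min ((\<beta> $ j)\<^sup>2) (\<mu>\<^sup>2)) \<le> \<Phi>" for T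
    unfolding \<Phi>_def by (rule sum_mono2) auto
  have "\<Phi> = (\<Sum>j\<in>supp \<beta>. min ((\<beta> $ j)\<^sup>2) (\<mu>\<^sup>2))"
    unfolding \<Phi>_def by (rule sum.mono_neutral_right) (auto simp: supp_def)
  also have "\<dots> \<le> (\<Sum>j\<in>supp \<beta>. \<mu>\<^sup>2)" by (intro sum_mono) simp
  finally have supp_ok: "\<Phi> \<le> real (card (supp \<beta>)) * \<mu>\<^sup>2" by simp
  then have \<Phi>_le: "\<Phi> \<le> real k * \<mu>\<^sup>2" unfolding k by (rule LeastI)
  show k_le: "k \<le> card (supp \<beta>)" unfolding k using supp_ok by (rule Least_le)
  show "1 \<le> k"
  proof (rule ccontr)
    assume "\<not> 1 \<le> k"
    then have "k = 0" by simp
    then have "\<Phi> \<le> 0" using \<Phi>_le by simp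
    moreover obtain i where "\<beta> $ i \<noteq> 0" using assms(2) by (auto simp: supp_def)
    then have "0 < (\<Sum>j\<in>{i}. min ((\<beta> $ j)\<^sup>2) (\<mu>\<^sup>2))" using assms(1) by simp
    ultimately show False using partial[of "{i}"] by simp
  qed
  obtain T0 where T0: "T0 \<subseteq> supp \<beta>" "card T0 = k"
    "\<forall>i\<in>T0. \<forall>j\<in>supp \<beta> - T0. \<bar>\<beta> $ j\<bar> \<le> \<bar>\<beta> $ i\<bar>"
    using top_subset[of "supp \<beta>" k "\<lambda>j. \<bar>\<beta> $ j\<bar>"] k_le by auto
  have small: "(\<beta> $ j)\<^sup>2 \<le> \<mu>\<^sup>2" if "j \<notin> T0" for j
  proof (rule ccontr)
    assume "\<not> (\<beta> $ j)\<^sup>2 \<le> \<mu>\<^sup>2"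
    then have large: "\<mu>\<^sup>2 < (\<beta> $ j)\<^sup>2" by simp
    then have j: "j \<in> supp \<beta> - T0" using that by (auto simp: supp_def)
    have "min ((\<beta> $ i)\<^sup>2) (\<mu>\<^sup>2) = \<mu>\<^sup>2" if "i \<in> insert j T0" for i
    proof -
      have "\<bar>\<beta> $ j\<bar> \<le> \<bar>\<beta> $ i\<bar>" using that j T0(3) by auto
      then have "(\<beta> $ j)\<^sup>2 \<le> (\<beta> $ i)\<^sup>2" by (simp add: abs_le_square_iff)
      then show ?thesis using large by simp
    qed
    then have "(\<Sum>i\<in>insert j T0. min ((\<beta> $ i)\<^sup>2) (\<mu>\<^sup>2)) = (\<Sum>i\<in>insert j T0. \<mu>\<^sup>2)"
      by (intro sum.cong) auto
    also have "\<dots> = (real k + 1) * \<mu>\<^sup>2" using that T0(2) by (simp add: algebra_simps)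
    finally have "(real k + 1) * \<mu>\<^sup>2 \<le> real k * \<mu>\<^sup>2"
      using partial[of "insert j T0"] \<Phi>_le by simp
    then show False using assms(1) by simp
  qed
  have "(\<Sum>j\<in>-T0. (\<beta> $ j)\<^sup>2) = (\<Sum>j\<in>-T0. min ((\<beta> $ j)\<^sup>2) (\<mu>\<^sup>2))"
    using small by (intro sum.cong) auto
  also have "\<dots> \<le> k * \<mu>\<^sup>2" using partial[of "- T0"] \<Phi>_le by simp
  finally show "\<exists>T0\<subseteq>supp \<beta>. card T0 = k \<and> (\<Sum>j\<in>-T0. (\<beta> $ j)\<^sup>2) \<le> k * \<mu>\<^sup>2"
    using T0 by blast
qed

section \<open>Least squares on a selected set\<close>

text \<open>
  \<open>block_inverse\<close> is a definite description, so both existence and uniqueness are at stake. For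
  existence the block is completed to an invertible matrix by the identity outside \<open>I\<close>.
\<close>

lemma block_inverse_works:
  fixes A :: "real ^ 'p ^ 'p"
  assumes inj: "\<And>x :: real ^ 'p. \<lbrakk>supp x \<subseteq> I; \<And>i. i \<in> I \<Longrightarrow> (\<Sum>k\<in>I. A $ i $ k * x $ k) = 0\<rbrakk> \<Longrightarrow> x = 0"
    and "i \<in> I" and "j \<in> I"
  shows "(\<Sum>k\<in>I. A $ i $ k * block_inverse I A $ k $ j) = (if i = j then 1 else 0)"
proof -
  define P where "P B \<longleftrightarrow> (\<forall>i j. i \<notin> I \<or> j \<notin> I \<longrightarrow> B $ i $ j = 0) \<and>
    (\<forall>i\<in>I. \<forall>j\<in>I. (\<Sum>k\<in>I. A $ i $ k * B $ k $ j) = (if i = j then 1 else 0)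
                \<and> (\<Sum>k\<in>I. B $ i $ k * A $ k $ j) = (if i = j then 1 else 0))" for B :: "real ^ 'p ^ 'p"
  define A' :: "real ^ 'p ^ 'p" where
    "A' = (\<chi> i k. if i \<in> I \<and> k \<in> I then A $ i $ k else if i = k then 1 else 0)"
  have row: "(\<Sum>k\<in>UNIV. A' $ i $ k * f k) = (\<Sum>k\<in>I. A $ i $ k * f k)" if "i \<in> I" for i f
    by (rule sum.mono_neutral_cong_right) (use that in \<open>auto simp: A'_def\<close>)
  have col: "(\<Sum>k\<in>UNIV. f k * A' $ k $ j) = (\<Sum>k\<in>I. f k * A $ k $ j)" if "j \<in> I" for j f
    by (rule sum.mono_neutral_cong_right) (use that in \<open>auto simp: A'_def\<close>)
  have "x = 0" if "A' *v x = 0" for x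
  proof (rule inj)
    show "supp x \<subseteq> I"
    proof
      fix i assume i: "i \<in> supp x"
      show "i \<in> I"
      proof (rule ccontr)
        assume "i \<notin> I"
        then have "(A' *v x) $ i = x $ i"
          by (simp add: matrix_vector_mult_def A'_def if_distrib[of "\<lambda>a. a * _"] cong: if_cong)
        then show False using i that by (simp add: supp_def)
      qed
    qed
    show "(\<Sum>k\<in>I. A $ i $ k * x $ k) = 0" if "i \<in> I" for i
      using \<open>A' *v x = 0\<close> row[OF that, of "\<lambda>k. x $ k"] by (simp add: matrix_vector_mult_def vec_eq_iff)
  qed
  then obtain B0 where B0: "B0 ** A' = mat 1" using matrix_left_invertible_ker by blast
  then have B0': "A' ** B0 = mat 1" by (simp add: matrix_left_right_inverse)
  define B :: "real ^ 'p ^ 'p" where "B = (\<chi> i j. if i \<in> I \<and> j \<in> I then B0 $ i $ j else 0)"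
  have B: "P B"
    unfolding P_def
  proof (intro conjI allI ballI impI)
    fix i j assume "i \<in> I" "j \<in> I"
    have "(\<Sum>k\<in>I. A $ i $ k * B $ k $ j) = (A' ** B0) $ i $ j"
      using \<open>i \<in> I\<close> \<open>j \<in> I\<close> row[of i "\<lambda>k. B0 $ k $ j"] by (simp add: matrix_matrix_mult_def B_def)
    then show "(\<Sum>k\<in>I. A $ i $ k * B $ k $ j) = (if i = j then 1 else 0)"
      by (simp add: B0' mat_def)
    have "(\<Sum>k\<in>I. B $ i $ k * A $ k $ j) = (B0 ** A') $ i $ j"
      using \<open>i \<in> I\<close> \<open>j \<in> I\<close> col[of j "\<lambda>k. B0 $ i $ k"] by (simp add: matrix_matrix_mult_def B_def)
    then show "(\<Sum>k\<in>I. B $ i $ k * A $ k $ j) = (if i = j then 1 else 0)"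
      by (simp add: B0 mat_def)
  qed (auto simp: B_def)
  have unique: "C = B" if "P C" for C
  proof -
    have "C $ i $ j = B $ i $ j" for i j
    proof (cases "i \<in> I \<and> j \<in> I")
      case True
      have "C $ i $ j = (\<Sum>k\<in>I. C $ i $ k * (\<Sum>l\<in>I. A $ k $ l * B $ l $ j))"
        using True B by (simp add: P_def if_distrib[of "\<lambda>x. _ * x"] cong: if_cong)
      also have "\<dots> = (\<Sum>l\<in>I. (\<Sum>k\<in>I. C $ i $ k * A $ k $ l) * B $ l $ j)"
        unfolding sum_distrib_left sum_distrib_right by (subst sum.swap) (simp add: mult.assoc)
      also have "\<dots> = B $ i $ j"
        using True that by (simp add: P_def if_distrib[of "\<lambda>x. x * _"] cong: if_cong)
      finally show ?thesis .
    next
      case False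
      then show ?thesis using B that unfolding P_def by metis
    qed
    then show ?thesis by (simp add: vec_eq_iff)
  qed
  have "block_inverse I A = (THE B. P B)"
    unfolding block_inverse_def P_def by (rule refl)
  also have "\<dots> = B" by (rule the_equality[of P, OF B unique])
  finally show ?thesis using B assms(2,3) by (simp add: P_def)
qed

context restricted_design
begin

text \<open>
  Restricted isometry makes the block of the Gram matrix indexed by \<open>I\<close> injective, so the block
  inverse is genuine and the refit solves the normal equations on \<open>I\<close>.
\<close>

lemma least_squares_normal_equations:
  assumes card: "card I \<le> 2 * s" and i: "i \<in> I"
  shows "column i X \<bullet> (Y - X *v restricted_least_squares X Y I) = 0"
proof -
  define A where "A = transpose (cols I X) ** cols I X"
  define z where "z = transpose (cols I X) *v Y"
  define b where "b = restricted_least_squares X Y I"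
  have A: "A $ i $ k = column i X \<bullet> column k X" if "i \<in> I" "k \<in> I" for i k
    using that by (simp add: A_def matrix_matrix_mult_def transpose_def cols_def column_def inner_vec_def)
  have z: "z $ i = (if i \<in> I then column i X \<bullet> Y else 0)" for i
    by (simp add: z_def matrix_vector_mult_def transpose_def cols_def column_def inner_vec_def)
  have Ax: "(\<Sum>k\<in>I. A $ i $ k * x $ k) = column i X \<bullet> (X *v x)" if "i \<in> I" "supp x \<subseteq> I" for i x
    unfolding inner_column_mult
    by (rule sum.mono_neutral_cong_left) (use that A in \<open>auto simp: supp_def\<close>)
  have inj: "x = 0" if x: "supp x \<subseteq> I" "\<And>i. i \<in> I \<Longrightarrow> (\<Sum>k\<in>I. A $ i $ k * x $ k) = 0" for x :: "real ^ 'p"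
  proof -
    have "x $ j * gram X (axis j 1) x = 0" for j
      using x Ax[OF _ x(1), of j] by (cases "j \<in> I") (auto simp: gram_axis supp_def)
    then have "gram X x x = 0" unfolding gram_sum_left[of X x x] by (intro sum.neutral) auto
    moreover have "card (supp x) \<le> 2 * s" using card card_mono[OF finite x(1)] by simp
    ultimately have "(1 - \<delta>) * (norm x)\<^sup>2 \<le> 0" using isometry_lower by metis
    moreover have "0 < 1 - \<delta>" using gap \<theta>_nonneg by simp
    ultimately show "x = 0" by (simp add: mult_le_0_iff)
  qed
  have "supp b \<subseteq> I" by (auto simp: b_def restricted_least_squares_def supp_def)
  then have "column i X \<bullet> (X *v b) = (\<Sum>k\<in>I. A $ i $ k * b $ k)" using Ax[OF i] by simp
  also have "\<dots> = (\<Sum>k\<in>I. A $ i $ k * (\<Sum>l\<in>I. block_inverse I A $ k $ l * z $ l))"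
  proof (intro sum.cong refl arg_cong2[where f = "(*)"])
    fix k assume "k \<in> I"
    then have "b $ k = (\<Sum>l\<in>UNIV. block_inverse I A $ k $ l * z $ l)"
      by (simp add: b_def restricted_least_squares_def A_def z_def matrix_vector_mult_def)
    also have "\<dots> = (\<Sum>l\<in>I. block_inverse I A $ k $ l * z $ l)"
      by (rule sum.mono_neutral_right) (auto simp: z)
    finally show "b $ k = (\<Sum>l\<in>I. block_inverse I A $ k $ l * z $ l)" .
  qed
  also have "\<dots> = (\<Sum>l\<in>I. (\<Sum>k\<in>I. A $ i $ k * block_inverse I A $ k $ l) * z $ l)"
    unfolding sum_distrib_left sum_distrib_right by (subst sum.swap) (simp add: mult.assoc)
  also have "\<dots> = (\<Sum>l\<in>I. (if i = l then 1 else 0) * z $ l)"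
    using block_inverse_works[of I A i, OF inj i] by (intro sum.cong) auto
  also have "\<dots> = column i X \<bullet> Y"
    using i by (simp add: z if_distrib[of "\<lambda>x. x * _"] cong: if_cong)
  finally show ?thesis by (simp add: b_def inner_diff_right)
qed

text \<open>
  On \<open>I\<close> the error is a vector \<open>w\<close>, off \<open>I\<close> it is minus the missed part \<open>r\<close> of \<open>\<beta>\<close>. By the
  normal equations \<open>w\<^sup>T G w\<close> is the correlation of \<open>w\<close> with the noise plus \<open>w\<^sup>T G r\<close>; the supports
  of \<open>w\<close> and \<open>r\<close> are disjoint, so the second term is controlled by \<open>\<theta>\<close>.
\<close>

lemma least_squares_error:
  fixes Y e :: "real ^ 'n" and \<beta> :: "real ^ 'p" and \<kappa> \<Lambda> :: real
  assumes Y: "Y = X *v \<beta> + e"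
    and noise: "\<And>j. \<bar>column j X \<bullet> e\<bar> / real CARD('n) \<le> \<kappa>"
    and card: "card I \<le> 2 * s" "card (supp \<beta>) \<le> s"
    and \<Lambda>: "\<theta> \<le> \<Lambda>" "0 < \<Lambda>" "\<And>v. card (supp v) \<le> card I \<Longrightarrow> \<Lambda> * (norm v)\<^sup>2 \<le> gram X v v"
  shows "(norm (restricted_least_squares X Y I - \<beta>))\<^sup>2
    \<le> 3 * (\<Sum>j\<in>-I. (\<beta> $ j)\<^sup>2) + 2 * card I * \<kappa>\<^sup>2 / \<Lambda>\<^sup>2"
proof -
  define b where "b = restricted_least_squares X Y I"
  define w where "w = restrict_vec I (b - \<beta>)"
  define r where "r = restrict_vec (-I) \<beta>"
  have \<kappa>: "0 \<le> \<kappa>" using noise by (rule order_trans[rotated]) auto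
  have b0: "b $ j = 0" if "j \<notin> I" for j using that by (simp add: b_def restricted_least_squares_def)
  have wr: "b - \<beta> = w - r" by (auto simp: vec_eq_iff w_def r_def b0)
  have "(norm (b - \<beta>))\<^sup>2 = (\<Sum>j\<in>I. ((b - \<beta>) $ j)\<^sup>2) + (\<Sum>j\<in>-I. ((b - \<beta>) $ j)\<^sup>2)"
    unfolding norm_vec_square using sum.subset_diff[of I UNIV "\<lambda>j. ((b - \<beta>) $ j)\<^sup>2"]
    by (simp add: Compl_eq_Diff_UNIV)
  also have "(\<Sum>j\<in>-I. ((b - \<beta>) $ j)\<^sup>2) = (norm r)\<^sup>2"
    unfolding r_def norm_restrict_vec by (intro sum.cong) (auto simp: b0)
  finally have pyth: "(norm (b - \<beta>))\<^sup>2 = (norm w)\<^sup>2 + (norm r)\<^sup>2"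
    by (simp add: w_def norm_restrict_vec)
  have sw: "supp w \<subseteq> I" unfolding w_def by (rule supp_restrict_vec)
  have cw: "card (supp w) \<le> card I" by (rule card_mono[OF finite sw])
  have noise_part: "gram X w (b - \<beta>) \<le> norm w * (\<kappa> * sqrt (card I))"
  proof -
    have "\<bar>gram X (axis i 1) (b - \<beta>)\<bar> \<le> \<kappa>" if "i \<in> I" for i
    proof -
      have "column i X \<bullet> (X *v (b - \<beta>)) = column i X \<bullet> e"
        using least_squares_normal_equations[OF card(1) that, of Y]
        by (simp add: b_def Y inner_diff_right inner_add_right matrix_vector_mult_diff_distrib)
      then show ?thesis using noise[of i] by (simp add: gram_axis)
    qed
    then have "\<bar>\<Sum>i\<in>UNIV. w $ i * gram X (axis i 1) (b - \<beta>)\<bar> \<le> (\<Sum>i\<in>UNIV. \<bar>w $ i\<bar> * \<kappa>)"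
      by (intro order_trans[OF sum_abs] sum_mono)
        (auto simp: w_def abs_mult intro!: mult_left_mono)
    then have "gram X w (b - \<beta>) \<le> \<kappa> * l1_norm w"
      by (simp add: gram_sum_left[of X w] l1_norm_def sum_distrib_left mult.commute)
    also have "\<dots> \<le> \<kappa> * (sqrt (card I) * norm w)"
      using \<kappa> sw by (intro mult_left_mono l1_norm_le_sqrt_card)
    finally show ?thesis by (simp add: mult_ac)
  qed
  have cross: "gram X w r \<le> \<theta> * norm w * norm r"
  proof -
    have "supp r \<subseteq> -I" "supp r \<subseteq> supp \<beta>" by (auto simp: r_def supp_def)
    then have "\<bar>gram X r w\<bar> \<le> \<theta> * norm r * norm w"
      using sw card cw card_mono[OF finite \<open>supp r \<subseteq> supp \<beta>\<close>] by (intro orthogonality) auto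
    then show ?thesis by (simp add: gram_commute[of X w] mult_ac)
  qed
  have "\<Lambda> * (norm w)\<^sup>2 \<le> gram X w w" using \<Lambda>(3)[OF cw] .
  also have "\<dots> = gram X w (b - \<beta>) + gram X w r"
    unfolding gram_simps(4)[symmetric] by (simp add: wr)
  also have "\<dots> \<le> norm w * (\<kappa> * sqrt (card I)) + norm w * (\<Lambda> * norm r)"
  proof -
    have "\<theta> * norm w * norm r \<le> \<Lambda> * norm w * norm r"
      using \<Lambda>(1) by (intro mult_right_mono) auto
    then show ?thesis using noise_part cross by (simp add: mult_ac)
  qed
  finally have quad: "norm w * (\<Lambda> * norm w) \<le> norm w * (\<kappa> * sqrt (card I) + \<Lambda> * norm r)"
    by (simp add: algebra_simps power2_eq_square)
  have "\<Lambda> * norm w \<le> \<kappa> * sqrt (card I) + \<Lambda> * norm r"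
  proof (cases "norm w = 0")
    case True
    then show ?thesis using \<kappa> \<Lambda>(2) by simp
  next
    case False
    then have "0 < norm w" by simp
    with quad show ?thesis by (simp only: mult_le_cancel_left_pos)
  qed
  then have "norm w \<le> \<kappa> * sqrt (card I) / \<Lambda> + norm r"
    using \<Lambda>(2) by (simp add: field_simps)
  then have "(norm w)\<^sup>2 \<le> (\<kappa> * sqrt (card I) / \<Lambda> + norm r)\<^sup>2"
    by (intro power_mono) auto
  also have "\<dots> \<le> 2 * (\<kappa> * sqrt (card I) / \<Lambda>)\<^sup>2 + 2 * (norm r)\<^sup>2"
    using sum_squares_bound[of "\<kappa> * sqrt (card I) / \<Lambda>" "norm r"] by (simp add: power2_sum)
  also have "\<dots> = 2 * card I * \<kappa>\<^sup>2 / \<Lambda>\<^sup>2 + 2 * (norm r)\<^sup>2"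
    by (simp add: power_divide power_mult_distrib)
  finally have "(norm (b - \<beta>))\<^sup>2 \<le> 3 * (norm r)\<^sup>2 + 2 * card I * \<kappa>\<^sup>2 / \<Lambda>\<^sup>2"
    unfolding pyth by simp
  then show ?thesis by (simp add: b_def r_def norm_restrict_vec)
qed

end

section \<open>Thresholding and refitting\<close>

context restricted_design
begin

text \<open>
  The constants that \<open>dantzig_head_tail\<close> produces are dominated by \<open>C0'\<close> and \<open>C1\<close>.
\<close>

lemma head_constant_le_C0': "(2 * sqrt 2 + (1 + \<delta>) + \<theta> * (1 + \<delta>) / 2) / (1 - \<delta> - \<theta>) \<le> C0' \<delta> \<theta>"
  and half_le_C1_increment: "(1 + \<delta>) / 2 \<le> (1 + \<delta>) / (1 - \<delta> - \<theta>)"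
proof -
  define \<eta> where "\<eta> = 1 - \<delta> - \<theta>"
  have \<eta>: "0 < \<eta>" "\<eta> \<le> 1" using gap \<delta>_nonneg \<theta>_nonneg by (auto simp: \<eta>_def)
  have \<delta>1: "0 \<le> 1 - \<delta>\<^sup>2" using gap \<delta>_nonneg \<theta>_nonneg by (simp add: power_le_one)
  have "1 + \<delta> \<le> (1 + \<delta>)\<^sup>2" using \<delta>_nonneg by (simp add: power2_eq_square algebra_simps)
  also have "\<dots> \<le> (1 + 1 / sqrt 2) * (1 + \<delta>)\<^sup>2" using \<delta>_nonneg by (simp add: mult_le_cancel_right1)
  also have "\<dots> \<le> (1 + 1 / sqrt 2) * (1 + \<delta>)\<^sup>2 / \<eta>"
    using \<eta> by (simp add: pos_le_divide_eq mult_left_le)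
  finally have "1 + \<delta> \<le> (1 + 1 / sqrt 2) * (1 + \<delta>)\<^sup>2 / \<eta>" .
  moreover have "2 * sqrt 2 * 1 \<le> 2 * sqrt 2 * (1 + (1 - \<delta>\<^sup>2) / \<eta>)"
    using \<eta> \<delta>1 by (intro mult_left_mono) auto
  ultimately have "2 * sqrt 2 + (1 + \<delta>) \<le> C0 \<delta> \<theta>"
    unfolding C0_def \<eta>_def by linarith
  moreover have "\<theta> * (1 + \<delta>) / 2 \<le> \<theta> * (1 + \<delta>) / \<eta>"
    using \<eta> \<delta>_nonneg \<theta>_nonneg by (intro divide_left_mono) auto
  ultimately have "(2 * sqrt 2 + (1 + \<delta>) + \<theta> * (1 + \<delta>) / 2) / \<eta> \<le> (C0 \<delta> \<theta> + \<theta> * (1 + \<delta>) / \<eta>) / \<eta>"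
    using \<eta> by (intro divide_right_mono add_mono) auto
  also have "\<dots> = C0' \<delta> \<theta>"
    using \<eta> by (simp add: C0'_def \<eta>_def[symmetric] add_divide_distrib power2_eq_square)
  finally show "(2 * sqrt 2 + (1 + \<delta>) + \<theta> * (1 + \<delta>) / 2) / (1 - \<delta> - \<theta>) \<le> C0' \<delta> \<theta>"
    by (simp add: \<eta>_def)
  show "(1 + \<delta>) / 2 \<le> (1 + \<delta>) / (1 - \<delta> - \<theta>)"
    using \<eta> \<delta>_nonneg unfolding \<eta>_def by (intro divide_left_mono) auto
qed

lemma gauss_dantzig_deterministic:
  fixes Y e :: "real ^ 'n" and \<beta> init :: "real ^ 'p" and \<mu> \<nu> \<kappa> t0 C4 :: real
  defines "k \<equiv> essential_sparsity \<mu> \<beta>" and "l \<equiv> \<kappa> + \<nu>"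
  defines "\<Lambda> \<equiv> Lambda_min X (2 * k)" and "I \<equiv> {j. \<bar>init $ j\<bar> \<ge> t0}"
  assumes Y: "Y = X *v \<beta> + e"
    and noise: "\<And>j. \<bar>column j X \<bullet> e\<bar> / real CARD('n) \<le> \<kappa>"
    and \<beta>: "supp \<beta> \<noteq> {}" "card (supp \<beta>) \<le> s"
    and \<mu>: "0 < \<mu>" "\<mu> \<le> \<nu>"
    and init: "dantzig_solution X Y l init"
    and t0: "C1 \<delta> \<theta> * l < t0" "t0 \<le> C4 * l"
  shows "card I \<le> 2 * k" and "card (I - supp \<beta>) \<le> k" and "k \<le> card (supp \<beta>)"
    and "(norm (restricted_least_squares X Y I - \<beta>))\<^sup>2
      \<le> (3 * l\<^sup>2 * ((C0' \<delta> \<theta> + C4)\<^sup>2 + 1) + 4 * \<kappa>\<^sup>2 / \<Lambda>\<^sup>2) * k"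
proof -
  have \<kappa>: "0 \<le> \<kappa>" using noise by (rule order_trans[rotated]) auto
  have noise': "\<bar>column j X \<bullet> e / real CARD('n)\<bar> \<le> \<kappa>" for j using noise[of j] by simp
  have l: "0 < l" "\<mu> \<le> l" "\<kappa> \<le> l" using \<kappa> \<mu> by (auto simp: l_def)
  have k: "1 \<le> k" "k \<le> card (supp \<beta>)" unfolding k_def
    using essential_sparsity_head(1,2)[OF \<mu>(1) \<beta>(1)] by simp_all
  have ks: "k \<le> s" using k(2) \<beta>(2) by simp
  show "k \<le> card (supp \<beta>)" by (rule k)
  obtain T0 where T0: "T0 \<subseteq> supp \<beta>" "card T0 = k" "(\<Sum>j\<in>-T0. (\<beta> $ j)\<^sup>2) \<le> k * \<mu>\<^sup>2"
    using essential_sparsity_head(3)[OF \<mu>(1) \<beta>(1)] unfolding k_def by blast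
  define \<beta>1 where "\<beta>1 = restrict_vec T0 \<beta>"
  define \<beta>2 where "\<beta>2 = restrict_vec (-T0) \<beta>"
  have sum12: "\<beta>1 + \<beta>2 = \<beta>" by (auto simp: vec_eq_iff \<beta>1_def \<beta>2_def)
  have n2: "(norm \<beta>2)\<^sup>2 \<le> k * \<mu>\<^sup>2" unfolding \<beta>2_def norm_restrict_vec by (rule T0(3))
  have "supp \<beta>2 \<subseteq> supp \<beta>" by (auto simp: \<beta>2_def supp_def)
  then have c2: "card (supp \<beta>2) \<le> s" using card_mono[OF finite] \<beta>(2) by (meson order_trans)
  have feasible: "dantzig_feasible X Y l (\<beta>1 + b)" if "\<And>j. \<bar>gram X (axis j 1) (\<beta>2 - b)\<bar> \<le> \<nu>" for b
    unfolding dantzig_feasible_iff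
  proof
    fix j
    have "Y - X *v (\<beta>1 + b) = X *v (\<beta>2 - b) + e"
      by (simp add: Y sum12[symmetric] matrix_vector_right_distrib matrix_vector_mult_diff_distrib)
    then have "column j X \<bullet> (Y - X *v (\<beta>1 + b)) / real CARD('n)
        = gram X (axis j 1) (\<beta>2 - b) + column j X \<bullet> e / real CARD('n)"
      by (simp add: gram_axis inner_add_right add_divide_distrib)
    then have "\<bar>column j X \<bullet> (Y - X *v (\<beta>1 + b)) / real CARD('n)\<bar> \<le> l"
      unfolding l_def using that[of j] noise'[of j] by linarith
    then show "\<bar>column j X \<bullet> (Y - X *v (\<beta>1 + b))\<bar> / real CARD('n) \<le> l" by simp
  qed
  have residual: "\<bar>gram X (axis j 1) (init - (\<beta>1 + \<beta>2))\<bar> \<le> 2 * l" for j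
  proof -
    have "X *v (init - \<beta>) = e - (Y - X *v init)"
      by (simp add: Y matrix_vector_mult_diff_distrib)
    then have "gram X (axis j 1) (init - \<beta>)
        = column j X \<bullet> e / real CARD('n) - column j X \<bullet> (Y - X *v init) / real CARD('n)"
      by (simp add: gram_axis inner_diff_right diff_divide_distrib)
    moreover have "\<bar>column j X \<bullet> (Y - X *v init) / real CARD('n)\<bar> \<le> l"
      using init by (simp add: dantzig_solution_def dantzig_feasible_iff)
    ultimately show ?thesis
      unfolding sum12 using noise'[of j] l(3) by linarith
  qed
  define K where "K = (2 * sqrt 2 + (1 + \<delta>) + \<theta> * (1 + \<delta>) / 2) / (1 - \<delta> - \<theta>)"
  have head_tail: "norm (restrict_vec T0 (init - \<beta>1)) \<le> K * l * sqrt k"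
    "(\<Sum>j\<in>-T0. \<bar>init $ j\<bar>) \<le> (K + (1 + \<delta>) / 2) * l * k"
  proof -
    have opt: "l1_norm init \<le> l1_norm (\<beta>1 + b)" if "\<And>j. \<bar>gram X (axis j 1) (\<beta>2 - b)\<bar> \<le> \<nu>" for b
      using init feasible[OF that] by (simp add: dantzig_solution_def)
    have s1: "supp \<beta>1 \<subseteq> T0" unfolding \<beta>1_def by (rule supp_restrict_vec)
    show "norm (restrict_vec T0 (init - \<beta>1)) \<le> K * l * sqrt k"
      "(\<Sum>j\<in>-T0. \<bar>init $ j\<bar>) \<le> (K + (1 + \<delta>) / 2) * l * k"
      using dantzig_head_tail[OF T0(2) k(1) ks s1 c2 n2 \<mu> l(2) opt residual] by (simp_all add: K_def)
  qed
  have "0 \<le> K" using \<delta>_nonneg \<theta>_nonneg gap by (simp add: K_def)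
  moreover have "K \<le> C0' \<delta> \<theta>" unfolding K_def by (rule head_constant_le_C0')
  ultimately have K: "0 \<le> K" "K \<le> C0' \<delta> \<theta>" "K + (1 + \<delta>) / 2 \<le> C1 \<delta> \<theta>"
    using half_le_C1_increment unfolding C1_def by linarith+
  have t0_pos: "0 < t0"
  proof -
    have "0 \<le> K + (1 + \<delta>) / 2" using K(1) \<delta>_nonneg by simp
    then have "0 \<le> C1 \<delta> \<theta>" using K(3) by (rule order_trans)
    then have "0 \<le> C1 \<delta> \<theta> * l" using l by simp
    then show ?thesis using t0(1) by linarith
  qed

  have fp: "card (I - T0) \<le> k"
  proof -
    have "real (card (I - T0)) * t0 = (\<Sum>j\<in>I - T0. t0)" by simp
    also have "\<dots> \<le> (\<Sum>j\<in>I - T0. \<bar>init $ j\<bar>)" by (intro sum_mono) (auto simp: I_def)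
    also have "\<dots> \<le> (\<Sum>j\<in>-T0. \<bar>init $ j\<bar>)" by (intro sum_mono2) auto
    also have "\<dots> \<le> (K + (1 + \<delta>) / 2) * l * k" by (rule head_tail)
    also have "\<dots> \<le> C1 \<delta> \<theta> * l * k" using K l by (intro mult_right_mono) auto
    also have "\<dots> \<le> t0 * k" using t0 by (intro mult_right_mono) auto
    finally have "real (card (I - T0)) \<le> real k" using t0_pos by simp
    then show ?thesis by simp
  qed
  have "card I \<le> card (I - T0) + card T0"
    using card_mono[of "(I - T0) \<union> T0" I] card_Un_le[of "I - T0" T0] by simp
  then show cI: "card I \<le> 2 * k" using fp T0(2) by simp
  have "card (I - supp \<beta>) \<le> card (I - T0)" using T0(1) by (intro card_mono) auto
  then show "card (I - supp \<beta>) \<le> k" using fp by simp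

  have missed: "(\<Sum>j\<in>-I. (\<beta> $ j)\<^sup>2) \<le> l\<^sup>2 * ((C0' \<delta> \<theta> + C4)\<^sup>2 + 1) * k"
  proof -
    have "(\<Sum>j\<in>T0 - I. (\<beta> $ j)\<^sup>2) \<le> ((C0' \<delta> \<theta> + C4) * l * sqrt k)\<^sup>2"
    proof -
      have "L2_set (\<lambda>j. \<bar>\<beta> $ j\<bar>) (T0 - I) \<le> L2_set (\<lambda>j. \<bar>(init - \<beta>1) $ j\<bar> + t0) (T0 - I)"
        by (intro L2_set_mono) (auto simp: I_def \<beta>1_def)
      also have "\<dots> \<le> L2_set (\<lambda>j. \<bar>(init - \<beta>1) $ j\<bar>) (T0 - I) + L2_set (\<lambda>j. t0) (T0 - I)"
        by (rule L2_set_triangle_ineq)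
      also have "L2_set (\<lambda>j. \<bar>(init - \<beta>1) $ j\<bar>) (T0 - I) \<le> norm (restrict_vec T0 (init - \<beta>1))"
      proof (rule power2_le_imp_le)
        show "(L2_set (\<lambda>j. \<bar>(init - \<beta>1) $ j\<bar>) (T0 - I))\<^sup>2 \<le> (norm (restrict_vec T0 (init - \<beta>1)))\<^sup>2"
          unfolding norm_restrict_vec by (simp add: L2_set_def sum_nonneg sum_mono2)
      qed simp
      also have "L2_set (\<lambda>j. t0) (T0 - I) = sqrt (card (T0 - I)) * t0"
        using t0_pos by (simp add: L2_set_def real_sqrt_mult)
      also have "norm (restrict_vec T0 (init - \<beta>1)) + sqrt (card (T0 - I)) * t0
          \<le> C0' \<delta> \<theta> * l * sqrt k + sqrt k * (C4 * l)"
      proof (rule add_mono)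
        have "K * l * sqrt k \<le> C0' \<delta> \<theta> * l * sqrt k" using K l by (intro mult_right_mono) auto
        then show "norm (restrict_vec T0 (init - \<beta>1)) \<le> C0' \<delta> \<theta> * l * sqrt k" using head_tail(1) by simp
        have "card (T0 - I) \<le> k" using T0(2) card_mono[of T0 "T0 - I"] by simp
        then show "sqrt (card (T0 - I)) * t0 \<le> sqrt k * (C4 * l)"
          using t0(2) t0_pos by (intro mult_mono real_sqrt_le_mono) auto
      qed
      finally have "sqrt (\<Sum>j\<in>T0 - I. (\<beta> $ j)\<^sup>2) \<le> (C0' \<delta> \<theta> + C4) * l * sqrt k"
        by (simp add: L2_set_def algebra_simps)
      then show ?thesis by (rule sqrt_le_D)
    qed
    also have "((C0' \<delta> \<theta> + C4) * l * sqrt k)\<^sup>2 = l\<^sup>2 * (C0' \<delta> \<theta> + C4)\<^sup>2 * k"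
      by (simp add: power_mult_distrib)
    finally have head: "(\<Sum>j\<in>T0 - I. (\<beta> $ j)\<^sup>2) \<le> l\<^sup>2 * (C0' \<delta> \<theta> + C4)\<^sup>2 * k" .
    have "\<mu>\<^sup>2 \<le> l\<^sup>2" using l(2) \<mu> by (intro power_mono) auto
    then have tail: "(\<Sum>j\<in>-T0. (\<beta> $ j)\<^sup>2) \<le> l\<^sup>2 * k"
      using T0(3) mult_left_mono[of "\<mu>\<^sup>2" "l\<^sup>2" "real k"] by (simp add: mult.commute)
    have "(\<Sum>j\<in>-I. (\<beta> $ j)\<^sup>2) \<le> (\<Sum>j\<in>(T0 - I) \<union> (-T0). (\<beta> $ j)\<^sup>2)"
      by (intro sum_mono2) auto
    also have "\<dots> = (\<Sum>j\<in>T0 - I. (\<beta> $ j)\<^sup>2) + (\<Sum>j\<in>-T0. (\<beta> $ j)\<^sup>2)"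
      by (intro sum.union_disjoint) auto
    finally show ?thesis using head tail by (simp add: algebra_simps)
  qed

  \<comment> \<open>\<open>2 k \<le> 2 s\<close> makes \<open>1 - \<delta>\<close>, and hence \<open>\<theta>\<close>, a lower bound of \<open>\<Lambda>\<close>.\<close>
  have quotient: "1 - \<delta> \<le> gram X v v / (norm v)\<^sup>2" if "v \<noteq> 0" "sparse (2 * k) v" for v
    using isometry_lower[of v] that ks by (simp add: sparse_def pos_le_divide_eq)
  have \<Lambda>_def': "\<Lambda> = (INF v\<in>{v. v \<noteq> 0 \<and> sparse (2 * k) v}. gram X v v / (norm v)\<^sup>2)"
    by (simp add: \<Lambda>_def Lambda_min_def gram_self)
  have \<Lambda>: "1 - \<delta> \<le> \<Lambda>"
    unfolding \<Lambda>_def'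
  proof (rule cINF_greatest)
    obtain j :: 'p where True by simp
    have "supp (axis j 1 :: real ^ 'p) = {j}" by (auto simp: supp_def axis_def)
    then show "{v :: real ^ 'p. v \<noteq> 0 \<and> sparse (2 * k) v} \<noteq> {}"
      using k(1) by (auto simp: sparse_def intro!: exI[of _ "axis j 1"])
  qed (use quotient in auto)
  have \<Lambda>_le: "\<Lambda> * (norm v)\<^sup>2 \<le> gram X v v" if "card (supp v) \<le> card I" for v
  proof (cases "v = 0")
    case False
    then have "\<Lambda> \<le> gram X v v / (norm v)\<^sup>2"
      unfolding \<Lambda>_def' using that cI
      by (intro cINF_lower bdd_belowI2[of _ 0]) (auto simp: sparse_def gram_nonneg)
    then show ?thesis using False by (simp add: pos_le_divide_eq)
  qed (simp add: gram_simps)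
  have \<Lambda>_pos: "0 < \<Lambda>" "\<theta> \<le> \<Lambda>" using \<Lambda> gap \<theta>_nonneg by auto
  have "(norm (restricted_least_squares X Y I - \<beta>))\<^sup>2
      \<le> 3 * (\<Sum>j\<in>-I. (\<beta> $ j)\<^sup>2) + 2 * card I * \<kappa>\<^sup>2 / \<Lambda>\<^sup>2"
    using cI ks by (intro least_squares_error[OF Y noise _ \<beta>(2) \<Lambda>_pos(2,1) \<Lambda>_le]) auto
  also have "\<dots> \<le> 3 * (l\<^sup>2 * ((C0' \<delta> \<theta> + C4)\<^sup>2 + 1) * k) + 2 * (2 * k) * \<kappa>\<^sup>2 / \<Lambda>\<^sup>2"
  proof -
    have "real (card I) \<le> 2 * real k" using cI by simp
    then have "2 * real (card I) * \<kappa>\<^sup>2 / \<Lambda>\<^sup>2 \<le> 2 * (2 * real k) * \<kappa>\<^sup>2 / \<Lambda>\<^sup>2"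
      by (intro divide_right_mono mult_right_mono) auto
    then show ?thesis using missed by simp
  qed
  also have "\<dots> = (3 * l\<^sup>2 * ((C0' \<delta> \<theta> + C4)\<^sup>2 + 1) + 4 * \<kappa>\<^sup>2 / \<Lambda>\<^sup>2) * k"
    by (simp add: algebra_simps)
  finally show "(norm (restricted_least_squares X Y I - \<beta>))\<^sup>2
      \<le> (3 * l\<^sup>2 * ((C0' \<delta> \<theta> + C4)\<^sup>2 + 1) + 4 * \<kappa>\<^sup>2 / \<Lambda>\<^sup>2) * k" .
qed

end

section \<open>Gaussian noise\<close>

text \<open>
  The Mills ratio bound: for \<open>y \<ge> t = x \<sigma>\<close> the density at \<open>y\<close> is at most \<open>y / t\<close> times itself, and
  this product has the antiderivative \<open>- (\<sigma>\<^sup>2 / t)\<close> times the density.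
\<close>

lemma (in prob_space) normal_upper_tail:
  assumes Z: "distributed M lborel Z (\<lambda>x. ennreal (normal_density 0 \<sigma> x))"
    and "0 < \<sigma>" and "0 < x"
  shows "prob {\<omega> \<in> space M. x * \<sigma> \<le> Z \<omega>} \<le> exp (- x\<^sup>2 / 2) / (x * sqrt (2 * pi))"
proof -
  let ?f = "normal_density 0 \<sigma>"
  define t where "t = x * \<sigma>"
  have t: "0 < t" using assms by (simp add: t_def)
  define F where "F y = - (\<sigma>\<^sup>2 / t) * ?f y" for y
  have "emeasure M (Z -` {t..} \<inter> space M) = (\<integral>\<^sup>+y. ennreal (?f y) * indicator {t..} y \<partial>lborel)"
    by (rule distributed_emeasure[OF Z]) simp
  also have "\<dots> \<le> (\<integral>\<^sup>+y. ennreal (y / t * ?f y) * indicator {t..} y \<partial>lborel)"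
  proof (rule nn_integral_mono)
    fix y
    show "ennreal (?f y) * indicator {t..} y \<le> ennreal (y / t * ?f y) * indicator {t..} y"
    proof (cases "t \<le> y")
      case True
      have "1 * ?f y \<le> y / t * ?f y" using True t by (intro mult_right_mono) auto
      then show ?thesis using True by (simp add: ennreal_leI)
    qed simp
  qed
  also have "\<dots> = ennreal (0 - F t)"
  proof (rule nn_integral_FTC_atLeast)
    show "(\<lambda>y. y / t * ?f y) \<in> borel_measurable borel" by measurable
    show "(F has_real_derivative y / t * ?f y) (at y)" for y
      unfolding F_def normal_density_def using \<open>0 < \<sigma>\<close> t
      by (auto intro!: derivative_eq_intros simp: field_simps power2_eq_square)
    show "0 \<le> y / t * ?f y" if "t \<le> y" for y using that t by simp
    show "(F \<longlongrightarrow> 0) at_top"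
      unfolding F_def normal_density_def using \<open>0 < \<sigma>\<close> t by real_asymp
  qed
  also have "0 - F t = exp (- x\<^sup>2 / 2) / (x * sqrt (2 * pi))"
    using assms(2,3) by (simp add: F_def normal_density_def t_def real_sqrt_mult field_simps power2_eq_square)
  finally have "emeasure M (Z -` {t..} \<inter> space M) \<le> ennreal (exp (- x\<^sup>2 / 2) / (x * sqrt (2 * pi)))" .
  moreover have "Z -` {t..} \<inter> space M = {\<omega> \<in> space M. x * \<sigma> \<le> Z \<omega>}" by (auto simp: t_def)
  ultimately show ?thesis
    using \<open>0 < x\<close> by (simp add: emeasure_eq_measure)
qed

lemma (in prob_space) normal_two_sided_tail:
  assumes Z: "distributed M lborel Z (\<lambda>x. ennreal (normal_density 0 \<sigma> x))"
    and "0 < \<sigma>" and "0 < x"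
  shows "prob {\<omega> \<in> space M. x * \<sigma> < \<bar>Z \<omega>\<bar>} \<le> 2 * exp (- x\<^sup>2 / 2) / (x * sqrt (2 * pi))"
proof -
  have [measurable]: "Z \<in> borel_measurable M" using distributed_measurable[OF Z] by simp
  have Z': "distributed M lborel (\<lambda>\<omega>. - Z \<omega>) (\<lambda>x. ennreal (normal_density 0 \<sigma> x))"
    using normal_density_affine[OF Z \<open>0 < \<sigma>\<close>, of "- 1" 0] by simp
  have "prob {\<omega> \<in> space M. x * \<sigma> < \<bar>Z \<omega>\<bar>}
      \<le> prob ({\<omega> \<in> space M. x * \<sigma> \<le> Z \<omega>} \<union> {\<omega> \<in> space M. x * \<sigma> \<le> - Z \<omega>})"
    by (rule finite_measure_mono) auto
  also have "\<dots> \<le> prob {\<omega> \<in> space M. x * \<sigma> \<le> Z \<omega>} + prob {\<omega> \<in> space M. x * \<sigma> \<le> - Z \<omega>}"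
    by (rule measure_Un_le) measurable
  also have "\<dots> \<le> exp (- x\<^sup>2 / 2) / (x * sqrt (2 * pi)) + exp (- x\<^sup>2 / 2) / (x * sqrt (2 * pi))"
    by (intro add_mono normal_upper_tail Z Z' assms(2,3))
  also have "\<dots> = 2 * exp (- x\<^sup>2 / 2) / (x * sqrt (2 * pi))"
    by (simp only: mult_2 add_divide_distrib)
  finally show ?thesis .
qed

text \<open>
  The sum runs over the nonzero coefficients only, because a normal law with variance \<open>0\<close> has no
  density.
\<close>

lemma (in prob_space) isotropic_gaussian_inner:
  fixes \<epsilon> :: "'a \<Rightarrow> real ^ 'n" and c :: "real ^ 'n"
  assumes \<epsilon>: "isotropic_gaussian M \<sigma> \<epsilon>" and "0 < \<sigma>" and "c \<noteq> 0"
  shows "distributed M lborel (\<lambda>\<omega>. c \<bullet> \<epsilon> \<omega>) (\<lambda>x. ennreal (normal_density 0 (norm c * \<sigma>) x))"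
proof -
  define J where "J = {i. c $ i \<noteq> 0}"
  have indep: "indep_vars (\<lambda>_. borel) (\<lambda>i \<omega>. \<epsilon> \<omega> $ i) UNIV"
    and law: "\<And>i. distributed M lborel (\<lambda>\<omega>. \<epsilon> \<omega> $ i) (\<lambda>x. ennreal (normal_density 0 \<sigma> x))"
    using \<epsilon> by (auto simp: isotropic_gaussian_def)
  have "indep_vars (\<lambda>_. borel) (\<lambda>i \<omega>. c $ i * \<epsilon> \<omega> $ i) J"
    by (rule indep_vars_compose2[OF indep_vars_subset[OF indep]]) auto
  moreover have "distributed M lborel (\<lambda>\<omega>. c $ i * \<epsilon> \<omega> $ i)
      (\<lambda>x. ennreal (normal_density 0 (\<bar>c $ i\<bar> * \<sigma>) x))" if "i \<in> J" for i
    using normal_density_affine[OF law[of i] \<open>0 < \<sigma>\<close>, of "c $ i" 0] that by (simp add: J_def)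
  moreover have "J \<noteq> {}" using \<open>c \<noteq> 0\<close> by (auto simp: J_def vec_eq_iff)
  ultimately have "distributed M lborel (\<lambda>\<omega>. \<Sum>i\<in>J. c $ i * \<epsilon> \<omega> $ i)
      (normal_density (\<Sum>i\<in>J. 0) (sqrt (\<Sum>i\<in>J. (\<bar>c $ i\<bar> * \<sigma>)\<^sup>2)))"
    using \<open>0 < \<sigma>\<close> by (intro sum_indep_normal) (auto simp: J_def)
  moreover have "(\<Sum>i\<in>J. c $ i * \<epsilon> \<omega> $ i) = c \<bullet> \<epsilon> \<omega>" for \<omega>
    unfolding inner_vec_def by (rule sum.mono_neutral_cong_left) (auto simp: J_def)
  moreover have "sqrt (\<Sum>i\<in>J. (\<bar>c $ i\<bar> * \<sigma>)\<^sup>2) = norm c * \<sigma>"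
  proof -
    have "(\<Sum>i\<in>J. (\<bar>c $ i\<bar> * \<sigma>)\<^sup>2) = (\<Sum>i\<in>UNIV. (c $ i)\<^sup>2 * \<sigma>\<^sup>2)"
      by (rule sum.mono_neutral_cong_left) (auto simp: J_def power_mult_distrib)
    also have "\<dots> = (norm c * \<sigma>)\<^sup>2"
      by (simp add: norm_vec_square power_mult_distrib sum_distrib_right)
    finally show ?thesis using \<open>0 < \<sigma>\<close> by simp
  qed
  ultimately show ?thesis by simp
qed

text \<open>
  With \<open>x\<^sup>2 / 2 = (1 + a) ln p\<close> the tail of one correlation carries a factor \<open>p powr - (1 + a)\<close>, and the
  union bound over \<open>p\<close> columns consumes one power of \<open>p\<close>.
\<close>

lemma (in prob_space) noise_correlation_bound:
  fixes X :: "real ^ 'p ^ 'n" and \<epsilon> :: "'a \<Rightarrow> real ^ 'n"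
  assumes \<epsilon>: "isotropic_gaussian M \<sigma> \<epsilon>" and "0 < \<sigma>"
    and unit: "\<And>j. norm (column j X) = sqrt (real CARD('n))"
    and p: "2 \<le> CARD('p)" and "0 < a"
  defines "\<kappa> \<equiv> sqrt (1 + a) * base_lambda CARD('n) CARD('p) * \<sigma>"
  defines "E \<equiv> {\<omega> \<in> space M. \<forall>j. \<bar>column j X \<bullet> \<epsilon> \<omega>\<bar> / real CARD('n) \<le> \<kappa>}"
  shows "E \<in> events"
    and "prob E \<ge> 1 - 1 / (sqrt (pi * ln (real CARD('p))) * real CARD('p) powr a)"
proof -
  define x where "x = sqrt (1 + a) * sqrt (2 * ln (real CARD('p)))"
  have lnp: "0 < ln (real CARD('p))" using p by simp
  have x: "0 < x" using lnp \<open>0 < a\<close> by (simp add: x_def)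
  have n: "0 < sqrt (real CARD('n))" "sqrt (real CARD('n)) * sqrt (real CARD('n)) = real CARD('n)" by auto
  have law: "distributed M lborel (\<lambda>\<omega>. column j X \<bullet> \<epsilon> \<omega>)
      (\<lambda>y. ennreal (normal_density 0 (sqrt (real CARD('n)) * \<sigma>) y))" for j
    using isotropic_gaussian_inner[OF \<epsilon> \<open>0 < \<sigma>\<close>, of "column j X"] unit[of j] by force
  have [measurable]: "(\<lambda>\<omega>. column j X \<bullet> \<epsilon> \<omega>) \<in> borel_measurable M" for j
    using distributed_measurable[OF law[of j]] by simp
  show E: "E \<in> events" unfolding E_def by measurable
  have cancel: "(r * r) * (q / r) = q * r" if "0 < r" for q r :: real using that by simp
  have level: "real CARD('n) * \<kappa> = x * (sqrt (real CARD('n)) * \<sigma>)"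
  proof -
    have "real CARD('n) * base_lambda CARD('n) CARD('p)
        = (sqrt (real CARD('n)) * sqrt (real CARD('n))) * (sqrt (2 * ln (real CARD('p))) / sqrt (real CARD('n)))"
      unfolding base_lambda_def n(2) by (simp only: real_sqrt_divide)
    also have "\<dots> = sqrt (2 * ln (real CARD('p))) * sqrt (real CARD('n))"
      using cancel[OF n(1)] .
    finally show ?thesis by (simp add: \<kappa>_def x_def mult_ac)
  qed
  have exceeds: "\<bar>y\<bar> / real CARD('n) \<le> \<kappa> \<longleftrightarrow> \<not> x * (sqrt (real CARD('n)) * \<sigma>) < \<bar>y\<bar>" for y
    unfolding level[symmetric] not_less by (subst pos_divide_le_eq) (auto simp: mult.commute)
  define B where "B j = {\<omega> \<in> space M. x * (sqrt (real CARD('n)) * \<sigma>) < \<bar>column j X \<bullet> \<epsilon> \<omega>\<bar>}" for j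
  have B [measurable]: "B j \<in> events" for j unfolding B_def by measurable
  have tail: "prob (B j) \<le> 2 * exp (- x\<^sup>2 / 2) / (x * sqrt (2 * pi))" for j
    unfolding B_def using normal_two_sided_tail[OF law[of j] _ x] n(1) \<open>0 < \<sigma>\<close> by simp
  have "space M - E = (\<Union>j. B j)"
    unfolding E_def B_def exceeds by auto
  then have "prob (space M - E) \<le> (\<Sum>j\<in>UNIV. prob (B j))"
    using finite_measure_subadditive_finite[of UNIV B] B
    by (simp add: image_subset_iff)
  also have "\<dots> \<le> (\<Sum>j\<in>(UNIV :: 'p set). 2 * exp (- x\<^sup>2 / 2) / (x * sqrt (2 * pi)))"
    by (intro sum_mono tail)
  also have "\<dots> = real CARD('p) * (2 * exp (- x\<^sup>2 / 2) / (x * sqrt (2 * pi)))" by simp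
  also have "\<dots> \<le> 1 / (sqrt (pi * ln (real CARD('p))) * real CARD('p) powr a)"
  proof -
    have "x\<^sup>2 = (1 + a) * (2 * ln (real CARD('p)))"
      using \<open>0 < a\<close> lnp by (simp add: x_def power_mult_distrib)
    then have x_sq: "- x\<^sup>2 / 2 = - (ln (real CARD('p)) + a * ln (real CARD('p)))"
      by (simp add: field_simps)
    have "exp (- x\<^sup>2 / 2) = 1 / (real CARD('p) * real CARD('p) powr a)"
      unfolding x_sq exp_minus exp_add powr_def by (simp add: inverse_eq_divide)
    moreover have "x * sqrt (2 * pi) = 2 * (sqrt (1 + a) * sqrt (pi * ln (real CARD('p))))"
      by (simp add: x_def real_sqrt_mult)
    ultimately have "real CARD('p) * (2 * exp (- x\<^sup>2 / 2) / (x * sqrt (2 * pi)))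
        = 1 / (sqrt (1 + a) * (sqrt (pi * ln (real CARD('p))) * real CARD('p) powr a))"
      by simp
    also have "\<dots> \<le> 1 / (1 * (sqrt (pi * ln (real CARD('p))) * real CARD('p) powr a))"
      using lnp \<open>0 < a\<close> by (intro divide_left_mono mult_right_mono) (auto intro!: mult_pos_pos)
    finally show ?thesis by simp
  qed
  finally show "prob E \<ge> 1 - 1 / (sqrt (pi * ln (real CARD('p))) * real CARD('p) powr a)"
    using prob_compl[OF E] by simp
qed

section \<open>The Gauss-Dantzig selector\<close>

theorem theoremG3:
  fixes M :: "'w measure"
    and X :: "real ^ 'p ^ 'n"
    and \<beta> :: "real ^ 'p"
    and \<epsilon> Y :: "'w \<Rightarrow> real ^ 'n"
    and \<beta>_init \<beta>_hat :: "'w \<Rightarrow> real ^ 'p"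
    and I :: "'w \<Rightarrow> 'p set"
    and S :: "'p set"
    and n p s s0 :: nat
    and \<sigma> \<tau> a \<delta> \<theta> lam lam_p\<tau> C4 t0 :: real
  assumes "n = CARD('n)" and "p = CARD('p)" and "n \<le> p" and "2 \<le> p"
    and "prob_space M"
    and "\<sigma> > 0" and "isotropic_gaussian M \<sigma> \<epsilon>"
    and "\<forall>\<omega>\<in>space M. Y \<omega> = X *v \<beta> + \<epsilon> \<omega>"
    and "\<forall>j. norm (column j X) = sqrt (real n)"
    and "\<tau> > 0" and "a > 0"
    and "lam = base_lambda n p"
    and "lam_p\<tau> = (sqrt (1 + a) + 1 / \<tau>) * base_lambda n p"
    and "S = supp \<beta>" and "s = card S" and "1 \<le> s" and "real s < real n / 3"
    and "\<delta> = restricted_isometry X (2 * s)"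
    and "\<theta> = restricted_orthogonality X s (2 * s)"
    and "\<delta> + \<theta> < 1 - \<tau>"
    and "s0 = essential_sparsity (lam * \<sigma>) \<beta>"
    and "\<forall>\<omega>\<in>space M. dantzig_solution X (Y \<omega>) (lam_p\<tau> * \<sigma>) (\<beta>_init \<omega>)"
    and "C1 \<delta> \<theta> \<le> C4"
    and "t0 \<in> {C1 \<delta> \<theta> * lam_p\<tau> * \<sigma> <.. C4 * lam_p\<tau> * \<sigma>}"
    and "\<forall>\<omega>\<in>space M. I \<omega> = {j. \<bar>\<beta>_init \<omega> $ j\<bar> \<ge> t0}"
    and "\<forall>\<omega>\<in>space M. \<beta>_hat \<omega> = restricted_least_squares X (Y \<omega>) (I \<omega>)"
  shows "\<exists>E\<in>sets M.
           measure M E \<ge> 1 - 1 / (sqrt (pi * ln (real p)) * real p powr a) \<and>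
           (\<forall>\<omega>\<in>E. card (I \<omega>) \<le> 2 * s0 \<and>
                   card (I \<omega> - S) \<le> s0 \<and> s0 \<le> s \<and>
                   (norm (\<beta>_hat \<omega> - \<beta>))\<^sup>2
                     \<le> (C3 a \<tau> \<delta> \<theta> C4 (Lambda_min X (2 * s0)))\<^sup>2 * lam\<^sup>2 * \<sigma>\<^sup>2 * real s0)"
proof -
  interpret prob_space M by (rule assms(5))
  note n = assms(1) and p = assms(2) and X_unit = assms(9) and lam = assms(12) and S = assms(14)
  have unit: "\<forall>j. norm (column j X) = sqrt (real CARD('n))" using X_unit n by simp
  have s: "1 \<le> s" "1 \<le> 2 * s" using assms(16) by auto
  have p2: "2 \<le> CARD('p)" using assms(4) p by simp
  have nonneg: "0 \<le> \<delta>" "0 \<le> \<theta>"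
    using restricted_isometry_attained(2)[OF unit s(2)] restricted_orthogonality_attained(2)[OF p2 s(1,2)]
    by (simp_all add: assms(18,19))
  have gap: "\<delta> + \<theta> < 1" using assms(10,20) by simp
  interpret restricted_design X s \<delta> \<theta>
    using restricted_isometry_attained(1)[OF unit s(2)] restricted_orthogonality_attained(1)[OF p2 s(1,2)]
      nonneg gap by unfold_locales (auto simp: assms(18,19))
  define \<mu> where "\<mu> = lam * \<sigma>"
  define \<kappa> where "\<kappa> = sqrt (1 + a) * lam * \<sigma>"
  define \<nu> where "\<nu> = 1 / \<tau> * \<mu>"
  have lam_pos: "0 < lam"
    using assms(4) n unfolding lam base_lambda_def by simp
  have \<mu>: "0 < \<mu>" using lam_pos assms(6) by (simp add: \<mu>_def)
  \<comment> \<open>\<open>\<delta>\<close> and \<open>\<theta>\<close> are nonnegative, so the gap \<open>\<tau>\<close> is less than \<open>1\<close>.\<close>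
  have "1 \<le> 1 / \<tau>" using assms(10,20) nonneg by simp
  then have \<nu>: "\<mu> \<le> \<nu>" using \<mu> mult_right_mono[of 1 "1 / \<tau>" \<mu>] by (simp add: \<nu>_def)
  have level: "lam_p\<tau> * \<sigma> = \<kappa> + \<nu>"
    unfolding assms(13) lam[symmetric] by (simp add: \<kappa>_def \<nu>_def \<mu>_def algebra_simps)
  define E where "E = {\<omega> \<in> space M. \<forall>j. \<bar>column j X \<bullet> \<epsilon> \<omega>\<bar> / real CARD('n) \<le> \<kappa>}"
  have \<kappa>_eq: "sqrt (1 + a) * base_lambda CARD('n) p * \<sigma> = \<kappa>"
    unfolding \<kappa>_def lam n ..
  have E: "E \<in> events" "prob E \<ge> 1 - 1 / (sqrt (pi * ln (real p)) * real p powr a)"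
    using noise_correlation_bound[OF assms(7,6) spec[OF unit] p2 assms(11)]
    unfolding p[symmetric] \<kappa>_eq E_def[symmetric] by simp_all
  have supp: "supp \<beta> \<noteq> {}" "card (supp \<beta>) \<le> s" using assms(14-16) by auto
  have C3: "(C3 a \<tau> \<delta> \<theta> C4 \<Lambda>)\<^sup>2 * lam\<^sup>2 * \<sigma>\<^sup>2
      = 3 * (\<kappa> + \<nu>)\<^sup>2 * ((C0' \<delta> \<theta> + C4)\<^sup>2 + 1) + 4 * \<kappa>\<^sup>2 / \<Lambda>\<^sup>2" for \<Lambda>
  proof -
    have "(C3 a \<tau> \<delta> \<theta> C4 \<Lambda>)\<^sup>2
        = 3 * (sqrt (1 + a) + 1 / \<tau>)\<^sup>2 * ((C0' \<delta> \<theta> + C4)\<^sup>2 + 1) + 4 * (1 + a) / \<Lambda>\<^sup>2"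
      unfolding C3_def using assms(11) by (intro real_sqrt_pow2) auto
    moreover have "(\<kappa> + \<nu>)\<^sup>2 = (sqrt (1 + a) + 1 / \<tau>)\<^sup>2 * lam\<^sup>2 * \<sigma>\<^sup>2"
      unfolding power_mult_distrib[symmetric] by (simp add: \<kappa>_def \<nu>_def \<mu>_def algebra_simps)
    moreover have "\<kappa>\<^sup>2 = (1 + a) * lam\<^sup>2 * \<sigma>\<^sup>2"
      using assms(11) by (simp add: \<kappa>_def power_mult_distrib)
    ultimately show ?thesis by (simp add: algebra_simps)
  qed
  have "card (I \<omega>) \<le> 2 * s0 \<and> card (I \<omega> - S) \<le> s0 \<and> s0 \<le> s \<and>
      (norm (\<beta>_hat \<omega> - \<beta>))\<^sup>2
        \<le> (C3 a \<tau> \<delta> \<theta> C4 (Lambda_min X (2 * s0)))\<^sup>2 * lam\<^sup>2 * \<sigma>\<^sup>2 * real s0"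
    if \<omega>: "\<omega> \<in> E" for \<omega>
  proof -
    have sp: "\<omega> \<in> space M" and noise: "\<And>j. \<bar>column j X \<bullet> \<epsilon> \<omega>\<bar> / real CARD('n) \<le> \<kappa>"
      using \<omega> by (auto simp: E_def)
    have Y: "Y \<omega> = X *v \<beta> + \<epsilon> \<omega>" using assms(8) sp by simp
    have init: "dantzig_solution X (Y \<omega>) (\<kappa> + \<nu>) (\<beta>_init \<omega>)"
      using assms(22) sp by (simp add: level)
    have t0: "C1 \<delta> \<theta> * (\<kappa> + \<nu>) < t0" "t0 \<le> C4 * (\<kappa> + \<nu>)"
      using assms(24) by (simp_all add: level[symmetric] mult.assoc)
    have s0: "s0 = essential_sparsity \<mu> \<beta>" by (simp add: assms(21) \<mu>_def)
    have I: "I \<omega> = {j. \<bar>\<beta>_init \<omega> $ j\<bar> \<ge> t0}" using assms(25) sp by simp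
    have hat: "\<beta>_hat \<omega> = restricted_least_squares X (Y \<omega>) (I \<omega>)" using assms(26) sp by simp
    show ?thesis
      unfolding C3 S hat assms(15) unfolding I s0
      using gauss_dantzig_deterministic[OF Y noise supp \<mu> \<nu> init t0] by blast
  qed
  with E show ?thesis by blast
qed

end
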